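(* Let $\mathcal{C}$ be a monoidal dagger category. The assignments $B\mapsto -\otimes B$ and $T\mapsto T(I)$ define an equivalence between the category of Frobenius monoids in $\mathcal{C}$ (with monoid homomorphisms) and the category of strong Frobenius monads on $\mathcal{C}$ (with morphisms of strong monads).
   Context: A dagger category has an identity-on-objects contravariant functor $f\mapsto f^\dagger$ with $f^{\dagger\dagger}=f$; a morphism $f$ is unitary if $f^\dagger=f^{-1}$. A monoidal dagger category is a monoidal category with a dagger such that $(f\otimes g)^\dagger=f^\dagger\otimes g^\dagger$ and associators $\alpha$ and unitors $\lambda,\rho$ are unitary. A monoid $(B,m,e)$ is a Frobenius monoid if $(\mathrm{id}\otimes m)\circ(m^\dagger\otimes\mathrm{id})=(m\otimes\mathrm{id})\circ(\mathrm{id}\otimes m^\dagger)$ (modulo associators). A Frobenius monad on $\mathcal{C}$ is a monad $(T,\mu,\eta)$ with $T(f^\dagger)=T(f)^\dagger$ for all $f$ and $T(\mu_A)\circ\mu^\dagger_{T(A)}=\mu_{T(A)}\circ T(\mu_A^\dagger)$ for all $A$. A strong monad is a monad with a natural transformation $\mathrm{st}_{A,B}\colon A\otimes T(B)\to T(A\otimes B)$ satisfying $\mathrm{st}\circ\alpha=T(\alpha)\circ\mathrm{st}\circ(\mathrm{id}\otimes\mathrm{st})$, $T(\lambda)\circ\mathrm{st}=\lambda$, $\mathrm{st}\circ(\mathrm{id}\otimes\mu)=\mu\circ T(\mathrm{st})\circ\mathrm{st}$ and $\mathrm{st}\circ(\mathrm{id}\otimes\eta)=\eta$. A strong Frobenius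 monad is a Frobenius monad that is a strong monad with every $\mathrm{st}_{A,B}$ unitary. A morphism of strong monads is a natural transformation $\beta\colon T\to S$ commuting with units, multiplications, and strengths ($\beta\circ\mathrm{st}=\mathrm{st}\circ(\mathrm{id}\otimes\beta)$). For a Frobenius monoid $B$, $-\otimes B$ is a monad with $\mu_A=\mathrm{id}_A\otimes m$ and $\eta_A=\mathrm{id}_A\otimes e$ and strength given by associators (modulo coherence). For a strong monad $T$, $T(I)$ is a monoid with multiplication $\mu_I\circ T(\rho_{T(I)})\circ\mathrm{st}_{T(I),I}$ and unit $\eta_I$. *)

theory Defs
  imports Main "HOL-Library.FuncSet"
begin

section \<open>Categories, functors, natural transformations\<close>

record ('o, 'm) cat =
  Obj :: "'o set"
  Arr :: "'m set"
  Dom :: "'m \<Rightarrow> 'o"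
  Cod :: "'m \<Rightarrow> 'o"
  Id :: "'o \<Rightarrow> 'm"
  Comp :: "'m \<Rightarrow> 'm \<Rightarrow> 'm" (infixr "\<cdot>\<index>" 55)

definition Hom :: "('o, 'm, 'z) cat_scheme \<Rightarrow> 'o \<Rightarrow> 'o \<Rightarrow> 'm set" where
  "Hom C A B = {f \<in> Arr C. Dom C f = A \<and> Cod C f = B}"

locale category =
  fixes C :: "('o, 'm, 'z) cat_scheme" (structure)
  assumes Dom_in_Obj: "f \<in> Arr C \<Longrightarrow> Dom C f \<in> Obj C"
    and Cod_in_Obj: "f \<in> Arr C \<Longrightarrow> Cod C f \<in> Obj C"
    and Id_in_Hom: "A \<in> Obj C \<Longrightarrow> Id C A \<in> Hom C A A"
    and Comp_in_Hom: "f \<in> Hom C X Y \<Longrightarrow> g \<in> Hom C Y Z \<Longrightarrow> g \<cdot> f \<in> Hom C X Z"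
    and Comp_Id_left: "f \<in> Hom C X Y \<Longrightarrow> Id C Y \<cdot> f = f"
    and Comp_Id_right: "f \<in> Hom C X Y \<Longrightarrow> f \<cdot> Id C X = f"
    and Comp_assoc: "f \<in> Hom C W X \<Longrightarrow> g \<in> Hom C X Y \<Longrightarrow> h \<in> Hom C Y Z \<Longrightarrow>
          (h \<cdot> g) \<cdot> f = h \<cdot> (g \<cdot> f)"

definition inverse_arrows :: "('o, 'm, 'z) cat_scheme \<Rightarrow> 'm \<Rightarrow> 'm \<Rightarrow> bool" where
  "inverse_arrows C f g \<longleftrightarrow>
     f \<in> Arr C \<and> g \<in> Hom C (Cod C f) (Dom C f) \<and>
     g \<cdot>\<^bsub>C\<^esub> f = Id C (Dom C f) \<and> f \<cdot>\<^bsub>C\<^esub> g = Id C (Cod C f)"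

definition is_iso :: "('o, 'm, 'z) cat_scheme \<Rightarrow> 'm \<Rightarrow> bool" where
  "is_iso C f \<longleftrightarrow> (\<exists>g. inverse_arrows C f g)"

definition inv_arr :: "('o, 'm, 'z) cat_scheme \<Rightarrow> 'm \<Rightarrow> 'm" where
  "inv_arr C f = (THE g. inverse_arrows C f g)"

text \<open>
  Functors and natural transformations are pairs of maps, respectively families, defined on the
  object and arrow sets only. They are therefore required to be \<^const>\<open>extensional\<close>, so that
  HOL equality of two of them is equality of functors and of natural transformations.
\<close>

record ('o, 'm, 'p, 'n) fctr =
  OnObj :: "'o \<Rightarrow> 'p"
  OnArr :: "'m \<Rightarrow> 'n"

definition is_functor ::
  "('o, 'm, 'y) cat_scheme \<Rightarrow> ('p, 'n, 'z) cat_scheme \<Rightarrow> ('o, 'm, 'p, 'n, 'x) fctr_scheme \<Rightarrow> bool"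
where
  "is_functor C D F \<longleftrightarrow>
     category C \<and> category D \<and>
     OnObj F \<in> Obj C \<rightarrow>\<^sub>E Obj D \<and>
     OnArr F \<in> extensional (Arr C) \<and>
     (\<forall>A B f. f \<in> Hom C A B \<longrightarrow> OnArr F f \<in> Hom D (OnObj F A) (OnObj F B)) \<and>
     (\<forall>A \<in> Obj C. OnArr F (Id C A) = Id D (OnObj F A)) \<and>
     (\<forall>X Y Z f g. f \<in> Hom C X Y \<and> g \<in> Hom C Y Z \<longrightarrow>
        OnArr F (g \<cdot>\<^bsub>C\<^esub> f) = OnArr F g \<cdot>\<^bsub>D\<^esub> OnArr F f)"

definition id_functor :: "('o, 'm, 'z) cat_scheme \<Rightarrow> ('o, 'm, 'o, 'm) fctr" where
  "id_functor C = \<lparr>OnObj = (\<lambda>A \<in> Obj C. A), OnArr = (\<lambda>f \<in> Arr C. f)\<rparr>"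

definition comp_functor ::
  "('o, 'm, 'z) cat_scheme \<Rightarrow> ('p, 'n, 'q, 'l, 'x) fctr_scheme \<Rightarrow> ('o, 'm, 'p, 'n, 'y) fctr_scheme
     \<Rightarrow> ('o, 'm, 'q, 'l) fctr"
where
  "comp_functor C G F =
     \<lparr>OnObj = (\<lambda>A \<in> Obj C. OnObj G (OnObj F A)), OnArr = (\<lambda>f \<in> Arr C. OnArr G (OnArr F f))\<rparr>"

definition natural_transformation ::
  "('o, 'm, 'y) cat_scheme \<Rightarrow> ('p, 'n, 'z) cat_scheme \<Rightarrow> ('o, 'm, 'p, 'n, 'w) fctr_scheme
     \<Rightarrow> ('o, 'm, 'p, 'n, 'x) fctr_scheme \<Rightarrow> ('o \<Rightarrow> 'n) \<Rightarrow> bool"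
where
  "natural_transformation C D F G \<tau> \<longleftrightarrow>
     is_functor C D F \<and> is_functor C D G \<and>
     \<tau> \<in> extensional (Obj C) \<and>
     (\<forall>A \<in> Obj C. \<tau> A \<in> Hom D (OnObj F A) (OnObj G A)) \<and>
     (\<forall>A B f. f \<in> Hom C A B \<longrightarrow> \<tau> B \<cdot>\<^bsub>D\<^esub> OnArr F f = OnArr G f \<cdot>\<^bsub>D\<^esub> \<tau> A)"

definition natural_isomorphism ::
  "('o, 'm, 'y) cat_scheme \<Rightarrow> ('p, 'n, 'z) cat_scheme \<Rightarrow> ('o, 'm, 'p, 'n, 'w) fctr_scheme
     \<Rightarrow> ('o, 'm, 'p, 'n, 'x) fctr_scheme \<Rightarrow> ('o \<Rightarrow> 'n) \<Rightarrow> bool"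
where
  "natural_isomorphism C D F G \<tau> \<longleftrightarrow>
     natural_transformation C D F G \<tau> \<and> (\<forall>A \<in> Obj C. is_iso D (\<tau> A))"

definition equivalence_of_categories ::
  "('o, 'm, 'y) cat_scheme \<Rightarrow> ('p, 'n, 'z) cat_scheme \<Rightarrow> ('o, 'm, 'p, 'n, 'w) fctr_scheme
     \<Rightarrow> ('p, 'n, 'o, 'm, 'x) fctr_scheme \<Rightarrow> bool"
where
  "equivalence_of_categories C D F G \<longleftrightarrow>
     is_functor C D F \<and> is_functor D C G \<and>
     (\<exists>\<eta>. natural_isomorphism C C (id_functor C) (comp_functor C G F) \<eta>) \<and>
     (\<exists>\<epsilon>. natural_isomorphism D D (comp_functor D F G) (id_functor D) \<epsilon>)"

section \<open>Monoidal dagger categories\<close>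

text \<open>
  The associator is oriented as \<open>\<alpha>\<^bsub>A,B,C\<^esub> : A \<otimes> (B \<otimes> C) \<rightarrow> (A \<otimes> B) \<otimes> C\<close>, which is the
  orientation forced by the law \<open>st \<circ> \<alpha> = T(\<alpha>) \<circ> st \<circ> (id \<otimes> st)\<close> of a strength.
  On objects the tensor product is written \<open>\<otimes>\<close>, on arrows \<open>\<boxtimes>\<close>.
\<close>

record ('o, 'm) mon_cat = "('o, 'm) cat" +
  TensorObj :: "'o \<Rightarrow> 'o \<Rightarrow> 'o" (infixr "\<otimes>\<index>" 70)
  TensorArr :: "'m \<Rightarrow> 'm \<Rightarrow> 'm" (infixr "\<boxtimes>\<index>" 70)
  UnitObj :: 'o
  Assoc :: "'o \<Rightarrow> 'o \<Rightarrow> 'o \<Rightarrow> 'm"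
  LUnitor :: "'o \<Rightarrow> 'm"
  RUnitor :: "'o \<Rightarrow> 'm"

locale monoidal_category = category C
  for C :: "('o, 'm, 'z) mon_cat_scheme" (structure) +
  assumes TensorObj_in_Obj: "A \<in> Obj C \<Longrightarrow> B \<in> Obj C \<Longrightarrow> A \<otimes> B \<in> Obj C"
    and UnitObj_in_Obj: "UnitObj C \<in> Obj C"
    and TensorArr_in_Hom: "f \<in> Hom C A A' \<Longrightarrow> g \<in> Hom C B B' \<Longrightarrow>
          f \<boxtimes> g \<in> Hom C (A \<otimes> B) (A' \<otimes> B')"
    and Tensor_Id: "A \<in> Obj C \<Longrightarrow> B \<in> Obj C \<Longrightarrow> Id C A \<boxtimes> Id C B = Id C (A \<otimes> B)"
    and Tensor_Comp: "f \<in> Hom C A A' \<Longrightarrow> f' \<in> Hom C A' A'' \<Longrightarrow>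
          g \<in> Hom C B B' \<Longrightarrow> g' \<in> Hom C B' B'' \<Longrightarrow>
          (f' \<cdot> f) \<boxtimes> (g' \<cdot> g) = (f' \<boxtimes> g') \<cdot> (f \<boxtimes> g)"
    and Assoc_in_Hom: "X \<in> Obj C \<Longrightarrow> Y \<in> Obj C \<Longrightarrow> Z \<in> Obj C \<Longrightarrow>
          Assoc C X Y Z \<in> Hom C (X \<otimes> (Y \<otimes> Z)) ((X \<otimes> Y) \<otimes> Z)"
    and Assoc_iso: "X \<in> Obj C \<Longrightarrow> Y \<in> Obj C \<Longrightarrow> Z \<in> Obj C \<Longrightarrow> is_iso C (Assoc C X Y Z)"
    and Assoc_natural: "f \<in> Hom C X X' \<Longrightarrow> g \<in> Hom C Y Y' \<Longrightarrow> h \<in> Hom C Z Z' \<Longrightarrow>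
          Assoc C X' Y' Z' \<cdot> (f \<boxtimes> (g \<boxtimes> h)) = ((f \<boxtimes> g) \<boxtimes> h) \<cdot> Assoc C X Y Z"
    and LUnitor_in_Hom: "A \<in> Obj C \<Longrightarrow> LUnitor C A \<in> Hom C (UnitObj C \<otimes> A) A"
    and LUnitor_iso: "A \<in> Obj C \<Longrightarrow> is_iso C (LUnitor C A)"
    and LUnitor_natural: "f \<in> Hom C A B \<Longrightarrow>
          LUnitor C B \<cdot> (Id C (UnitObj C) \<boxtimes> f) = f \<cdot> LUnitor C A"
    and RUnitor_in_Hom: "A \<in> Obj C \<Longrightarrow> RUnitor C A \<in> Hom C (A \<otimes> UnitObj C) A"
    and RUnitor_iso: "A \<in> Obj C \<Longrightarrow> is_iso C (RUnitor C A)"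
    and RUnitor_natural: "f \<in> Hom C A B \<Longrightarrow>
          RUnitor C B \<cdot> (f \<boxtimes> Id C (UnitObj C)) = f \<cdot> RUnitor C A"
    and pentagon: "W \<in> Obj C \<Longrightarrow> X \<in> Obj C \<Longrightarrow> Y \<in> Obj C \<Longrightarrow> Z \<in> Obj C \<Longrightarrow>
          Assoc C (W \<otimes> X) Y Z \<cdot> Assoc C W X (Y \<otimes> Z) =
          (Assoc C W X Y \<boxtimes> Id C Z) \<cdot> (Assoc C W (X \<otimes> Y) Z \<cdot> (Id C W \<boxtimes> Assoc C X Y Z))"
    and triangle: "A \<in> Obj C \<Longrightarrow> B \<in> Obj C \<Longrightarrow>
          (RUnitor C A \<boxtimes> Id C B) \<cdot> Assoc C A (UnitObj C) B = Id C A \<boxtimes> LUnitor C B"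

locale dagger_category = category C
  for C :: "('o, 'm, 'z) cat_scheme" (structure) +
  fixes dag :: "'m \<Rightarrow> 'm"
  assumes dag_in_Hom: "f \<in> Hom C A B \<Longrightarrow> dag f \<in> Hom C B A"
    and dag_Id: "A \<in> Obj C \<Longrightarrow> dag (Id C A) = Id C A"
    and dag_Comp: "f \<in> Hom C X Y \<Longrightarrow> g \<in> Hom C Y Z \<Longrightarrow> dag (g \<cdot> f) = dag f \<cdot> dag g"
    and dag_dag: "f \<in> Arr C \<Longrightarrow> dag (dag f) = f"

definition unitary :: "('o, 'm, 'z) cat_scheme \<Rightarrow> ('m \<Rightarrow> 'm) \<Rightarrow> 'm \<Rightarrow> bool" where
  "unitary C dag f \<longleftrightarrow> inverse_arrows C f (dag f)"

record ('o, 'm) dag_mon_cat = "('o, 'm) mon_cat" +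
  Dag :: "'m \<Rightarrow> 'm"

locale monoidal_dagger_category = monoidal_category C + dagger_category C "Dag C"
  for C :: "('o, 'm, 'z) dag_mon_cat_scheme" (structure) +
  assumes dag_Tensor: "f \<in> Arr C \<Longrightarrow> g \<in> Arr C \<Longrightarrow> Dag C (f \<boxtimes> g) = Dag C f \<boxtimes> Dag C g"
    and Assoc_unitary: "X \<in> Obj C \<Longrightarrow> Y \<in> Obj C \<Longrightarrow> Z \<in> Obj C \<Longrightarrow>
          unitary C (Dag C) (Assoc C X Y Z)"
    and LUnitor_unitary: "A \<in> Obj C \<Longrightarrow> unitary C (Dag C) (LUnitor C A)"
    and RUnitor_unitary: "A \<in> Obj C \<Longrightarrow> unitary C (Dag C) (RUnitor C A)"

text \<open>
  An arrow between structured objects, recorded with its source and target structures: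
  the same underlying morphism (or family) may be a homomorphism between several of them.
\<close>

datatype ('x, 'a) str_arr = StrArr (src: 'x) (tgt: 'x) (und: 'a)

section \<open>Frobenius monoids\<close>

record ('o, 'm) mon_obj =
  MObj :: 'o
  MMult :: 'm
  MUnit :: 'm

locale monoid_object = monoidal_category C
  for C :: "('o, 'm, 'z) mon_cat_scheme" (structure) +
  fixes B :: "('o, 'm) mon_obj"
  assumes MObj_in_Obj: "MObj B \<in> Obj C"
    and MMult_in_Hom: "MMult B \<in> Hom C (MObj B \<otimes> MObj B) (MObj B)"
    and MUnit_in_Hom: "MUnit B \<in> Hom C (UnitObj C) (MObj B)"
    and MMult_assoc:
      "MMult B \<cdot> ((MMult B \<boxtimes> Id C (MObj B)) \<cdot> Assoc C (MObj B) (MObj B) (MObj B)) =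
       MMult B \<cdot> (Id C (MObj B) \<boxtimes> MMult B)"
    and MUnit_left: "MMult B \<cdot> (MUnit B \<boxtimes> Id C (MObj B)) = LUnitor C (MObj B)"
    and MUnit_right: "MMult B \<cdot> (Id C (MObj B) \<boxtimes> MUnit B) = RUnitor C (MObj B)"

locale frobenius_monoid = monoidal_dagger_category C + monoid_object C B
  for C :: "('o, 'm, 'z) dag_mon_cat_scheme" (structure) and B :: "('o, 'm) mon_obj" +
  assumes frobenius_law:
    "(Id C (MObj B) \<boxtimes> MMult B) \<cdot>
       (inv_arr C (Assoc C (MObj B) (MObj B) (MObj B)) \<cdot> (Dag C (MMult B) \<boxtimes> Id C (MObj B))) =
     (MMult B \<boxtimes> Id C (MObj B)) \<cdot>
       (Assoc C (MObj B) (MObj B) (MObj B) \<cdot> (Id C (MObj B) \<boxtimes> Dag C (MMult B)))"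

definition monoid_hom ::
  "('o, 'm, 'z) mon_cat_scheme \<Rightarrow> ('o, 'm) mon_obj \<Rightarrow> ('o, 'm) mon_obj \<Rightarrow> 'm \<Rightarrow> bool"
where
  "monoid_hom C A B f \<longleftrightarrow>
     f \<in> Hom C (MObj A) (MObj B) \<and>
     f \<cdot>\<^bsub>C\<^esub> MMult A = MMult B \<cdot>\<^bsub>C\<^esub> (f \<boxtimes>\<^bsub>C\<^esub> f) \<and>
     f \<cdot>\<^bsub>C\<^esub> MUnit A = MUnit B"

definition FrobMonoids ::
  "('o, 'm, 'z) dag_mon_cat_scheme \<Rightarrow> (('o, 'm) mon_obj, (('o, 'm) mon_obj, 'm) str_arr) cat"
where
  "FrobMonoids C =
     \<lparr>Obj = {B. frobenius_monoid C B},
      Arr = {StrArr A B f | A B f.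
               frobenius_monoid C A \<and> frobenius_monoid C B \<and> monoid_hom C A B f},
      Dom = src,
      Cod = tgt,
      Id = (\<lambda>B. StrArr B B (Id C (MObj B))),
      Comp = (\<lambda>g f. StrArr (src f) (tgt g) (und g \<cdot>\<^bsub>C\<^esub> und f))\<rparr>"

section \<open>Strong Frobenius monads\<close>

record ('o, 'm) mnd = "('o, 'm, 'o, 'm) fctr" +
  Mu :: "'o \<Rightarrow> 'm"
  Eta :: "'o \<Rightarrow> 'm"

record ('o, 'm) str_mnd = "('o, 'm) mnd" +
  St :: "'o \<times> 'o \<Rightarrow> 'm"

locale monad = category C
  for C :: "('o, 'm, 'z) cat_scheme" (structure) +
  fixes T :: "('o, 'm, 'y) mnd_scheme"
  assumes monad_functor: "is_functor C C T"
    and Mu_natural: "natural_transformation C C (comp_functor C T T) T (Mu T)"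
    and Eta_natural: "natural_transformation C C (id_functor C) T (Eta T)"
    and Mu_assoc: "A \<in> Obj C \<Longrightarrow> Mu T A \<cdot> OnArr T (Mu T A) = Mu T A \<cdot> Mu T (OnObj T A)"
    and Mu_Eta_left: "A \<in> Obj C \<Longrightarrow> Mu T A \<cdot> Eta T (OnObj T A) = Id C (OnObj T A)"
    and Mu_Eta_right: "A \<in> Obj C \<Longrightarrow> Mu T A \<cdot> OnArr T (Eta T A) = Id C (OnObj T A)"

locale frobenius_monad = dagger_category C dag + monad C T
  for C :: "('o, 'm, 'z) cat_scheme" (structure) and dag :: "'m \<Rightarrow> 'm"
    and T :: "('o, 'm, 'y) mnd_scheme" +
  assumes functor_dag: "f \<in> Arr C \<Longrightarrow> OnArr T (dag f) = dag (OnArr T f)"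
    and monad_frobenius_law: "A \<in> Obj C \<Longrightarrow>
      OnArr T (Mu T A) \<cdot> dag (Mu T (OnObj T A)) = Mu T (OnObj T A) \<cdot> OnArr T (dag (Mu T A))"

locale strong_monad = monoidal_category C + monad C T
  for C :: "('o, 'm, 'z) mon_cat_scheme" (structure) and T :: "('o, 'm, 'y) str_mnd_scheme" +
  assumes St_extensional: "St T \<in> extensional (Obj C \<times> Obj C)"
    and St_in_Hom: "A \<in> Obj C \<Longrightarrow> B \<in> Obj C \<Longrightarrow>
      St T (A, B) \<in> Hom C (A \<otimes> OnObj T B) (OnObj T (A \<otimes> B))"
    and St_natural: "f \<in> Hom C A A' \<Longrightarrow> g \<in> Hom C B B' \<Longrightarrow>
      St T (A', B') \<cdot> (f \<boxtimes> OnArr T g) = OnArr T (f \<boxtimes> g) \<cdot> St T (A, B)"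
    and St_Assoc: "X \<in> Obj C \<Longrightarrow> Y \<in> Obj C \<Longrightarrow> Z \<in> Obj C \<Longrightarrow>
      St T (X \<otimes> Y, Z) \<cdot> Assoc C X Y (OnObj T Z) =
      OnArr T (Assoc C X Y Z) \<cdot> (St T (X, Y \<otimes> Z) \<cdot> (Id C X \<boxtimes> St T (Y, Z)))"
    and St_LUnitor: "A \<in> Obj C \<Longrightarrow>
      OnArr T (LUnitor C A) \<cdot> St T (UnitObj C, A) = LUnitor C (OnObj T A)"
    and St_Mu: "A \<in> Obj C \<Longrightarrow> B \<in> Obj C \<Longrightarrow>
      St T (A, B) \<cdot> (Id C A \<boxtimes> Mu T B) =
      Mu T (A \<otimes> B) \<cdot> (OnArr T (St T (A, B)) \<cdot> St T (A, OnObj T B))"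
    and St_Eta: "A \<in> Obj C \<Longrightarrow> B \<in> Obj C \<Longrightarrow>
      St T (A, B) \<cdot> (Id C A \<boxtimes> Eta T B) = Eta T (A \<otimes> B)"

locale strong_frobenius_monad =
  monoidal_dagger_category C + frobenius_monad C "Dag C" T + strong_monad C T
  for C :: "('o, 'm, 'z) dag_mon_cat_scheme" (structure) and T :: "('o, 'm) str_mnd" +
  assumes St_unitary: "A \<in> Obj C \<Longrightarrow> B \<in> Obj C \<Longrightarrow> unitary C (Dag C) (St T (A, B))"

definition strong_monad_hom ::
  "('o, 'm, 'z) mon_cat_scheme \<Rightarrow> ('o, 'm, 'x) str_mnd_scheme \<Rightarrow> ('o, 'm, 'y) str_mnd_scheme
     \<Rightarrow> ('o \<Rightarrow> 'm) \<Rightarrow> bool"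
where
  "strong_monad_hom C T S \<beta> \<longleftrightarrow>
     natural_transformation C C T S \<beta> \<and>
     (\<forall>A \<in> Obj C. \<beta> A \<cdot>\<^bsub>C\<^esub> Eta T A = Eta S A) \<and>
     (\<forall>A \<in> Obj C. \<beta> A \<cdot>\<^bsub>C\<^esub> Mu T A = Mu S A \<cdot>\<^bsub>C\<^esub> (\<beta> (OnObj S A) \<cdot>\<^bsub>C\<^esub> OnArr T (\<beta> A))) \<and>
     (\<forall>A \<in> Obj C. \<forall>B \<in> Obj C.
        \<beta> (A \<otimes>\<^bsub>C\<^esub> B) \<cdot>\<^bsub>C\<^esub> St T (A, B) = St S (A, B) \<cdot>\<^bsub>C\<^esub> (Id C A \<boxtimes>\<^bsub>C\<^esub> \<beta> B))"

definition StrongFrobMonads ::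
  "('o, 'm, 'z) dag_mon_cat_scheme
     \<Rightarrow> (('o, 'm) str_mnd, (('o, 'm) str_mnd, 'o \<Rightarrow> 'm) str_arr) cat"
where
  "StrongFrobMonads C =
     \<lparr>Obj = {T. strong_frobenius_monad C T},
      Arr = {StrArr T S \<beta> | T S \<beta>.
               strong_frobenius_monad C T \<and> strong_frobenius_monad C S \<and> strong_monad_hom C T S \<beta>},
      Dom = src,
      Cod = tgt,
      Id = (\<lambda>T. StrArr T T (\<lambda>A \<in> Obj C. Id C (OnObj T A))),
      Comp = (\<lambda>g f. StrArr (src f) (tgt g) (\<lambda>A \<in> Obj C. und g A \<cdot>\<^bsub>C\<^esub> und f A))\<rparr>"

section \<open>The two assignments\<close>

text \<open>
  With the associators and unitors written out, the monad \<open>- \<otimes> B\<close> has multiplication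
  \<open>(A \<otimes> B) \<otimes> B \<rightarrow> A \<otimes> (B \<otimes> B) \<rightarrow> A \<otimes> B\<close>, unit \<open>A \<rightarrow> A \<otimes> I \<rightarrow> A \<otimes> B\<close> and
  strength \<open>\<alpha> : X \<otimes> (Y \<otimes> B) \<rightarrow> (X \<otimes> Y) \<otimes> B\<close>.
\<close>

definition tensor_monad ::
  "('o, 'm, 'z) mon_cat_scheme \<Rightarrow> ('o, 'm) mon_obj \<Rightarrow> ('o, 'm) str_mnd"
where
  "tensor_monad C B =
     \<lparr>OnObj = (\<lambda>A \<in> Obj C. A \<otimes>\<^bsub>C\<^esub> MObj B),
      OnArr = (\<lambda>f \<in> Arr C. f \<boxtimes>\<^bsub>C\<^esub> Id C (MObj B)),
      Mu = (\<lambda>A \<in> Obj C.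
              (Id C A \<boxtimes>\<^bsub>C\<^esub> MMult B) \<cdot>\<^bsub>C\<^esub> inv_arr C (Assoc C A (MObj B) (MObj B))),
      Eta = (\<lambda>A \<in> Obj C. (Id C A \<boxtimes>\<^bsub>C\<^esub> MUnit B) \<cdot>\<^bsub>C\<^esub> inv_arr C (RUnitor C A)),
      St = (\<lambda>(X, Y) \<in> Obj C \<times> Obj C. Assoc C X Y (MObj B))\<rparr>"

definition tensor_functor ::
  "('o, 'm, 'z) dag_mon_cat_scheme
     \<Rightarrow> (('o, 'm) mon_obj, (('o, 'm) mon_obj, 'm) str_arr,
         ('o, 'm) str_mnd, (('o, 'm) str_mnd, 'o \<Rightarrow> 'm) str_arr) fctr"
where
  "tensor_functor C =
     \<lparr>OnObj = (\<lambda>B \<in> Obj (FrobMonoids C). tensor_monad C B),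
      OnArr = (\<lambda>f \<in> Arr (FrobMonoids C).
                 StrArr (tensor_monad C (src f)) (tensor_monad C (tgt f))
                   (\<lambda>A \<in> Obj C. Id C A \<boxtimes>\<^bsub>C\<^esub> und f))\<rparr>"

definition monoid_of_monad ::
  "('o, 'm, 'z) mon_cat_scheme \<Rightarrow> ('o, 'm) str_mnd \<Rightarrow> ('o, 'm) mon_obj"
where
  "monoid_of_monad C T =
     (let I = UnitObj C; TI = OnObj T I in
      \<lparr>MObj = TI,
       MMult = Mu T I \<cdot>\<^bsub>C\<^esub> (OnArr T (RUnitor C TI) \<cdot>\<^bsub>C\<^esub> St T (TI, I)),
       MUnit = Eta T I\<rparr>)"

definition eval_unit_functor ::
  "('o, 'm, 'z) dag_mon_cat_scheme
     \<Rightarrow> (('o, 'm) str_mnd, (('o, 'm) str_mnd, 'o \<Rightarrow> 'm) str_arr,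
         ('o, 'm) mon_obj, (('o, 'm) mon_obj, 'm) str_arr) fctr"
where
  "eval_unit_functor C =
     \<lparr>OnObj = (\<lambda>T \<in> Obj (StrongFrobMonads C). monoid_of_monad C T),
      OnArr = (\<lambda>\<beta> \<in> Arr (StrongFrobMonads C).
                 StrArr (monoid_of_monad C (src \<beta>)) (monoid_of_monad C (tgt \<beta>))
                   (und \<beta> (UnitObj C)))\<rparr>"

end

theory Submission
  imports Defs
begin

text \<open>
  For a strong monad \<open>T\<close> let \<open>\<theta>\<^bsub>A\<^esub> = T(\<rho>\<^bsub>A\<^esub>) \<circ> st\<^bsub>A,I\<^esub> : A \<otimes> T(I) \<rightarrow> T(A)\<close>, which is
  \<open>tensor_comparison C T A\<close> below. It is natural, and if \<open>m = \<mu>\<^bsub>I\<^esub> \<circ> \<theta>\<^bsub>T(I)\<^esub>\<close> is the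
  multiplication of \<open>T(I)\<close>, the strength laws give
  \<open>\<theta>\<^bsub>A\<^esub> \<circ> (id \<otimes> m) = \<mu>\<^bsub>A\<^esub> \<circ> \<theta>\<^bsub>T(A)\<^esub> \<circ> (\<theta>\<^bsub>A\<^esub> \<otimes> id) \<circ> \<alpha>\<close>.
  This single identity turns the monad laws into the monoid laws of \<open>T(I)\<close> and makes \<open>\<theta>\<close> a morphism
  of strong monads \<open>- \<otimes> T(I) \<rightarrow> T\<close>. When the strength is unitary so is \<open>\<theta>\<close>, hence it transports
  the Frobenius law of \<open>T\<close> at \<open>I\<close> to that of \<open>T(I)\<close>, and it is the counit of the equivalence; the
  unit is the inverse left unitor \<open>B \<rightarrow> I \<otimes> B\<close>.
\<close>

section \<open>Composition and isomorphisms\<close>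

context category
begin

lemma Hom_iff: "f \<in> Hom C A B \<longleftrightarrow> f \<in> Arr C \<and> Dom C f = A \<and> Cod C f = B"
  by (simp add: Hom_def)

lemma Id_simps [simp]:
  assumes "A \<in> Obj C"
  shows "Id C A \<in> Arr C" "Dom C (Id C A) = A" "Cod C (Id C A) = A"
  using Id_in_Hom[OF assms] by (auto simp: Hom_iff)

lemma Dom_Cod_Obj [simp]:
  assumes "f \<in> Arr C"
  shows "Dom C f \<in> Obj C" "Cod C f \<in> Obj C"
  using assms Dom_in_Obj Cod_in_Obj by auto

lemma Comp_simps [simp]:
  assumes "f \<in> Arr C" "g \<in> Arr C" "Dom C g = Cod C f"
  shows "g \<cdot> f \<in> Arr C" "Dom C (g \<cdot> f) = Dom C f" "Cod C (g \<cdot> f) = Cod C g"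
  using Comp_in_Hom[of f "Dom C f" "Cod C f" g "Cod C g"] assms by (auto simp: Hom_iff)

lemma Comp_Id [simp]:
  assumes "f \<in> Arr C"
  shows "Cod C f = Y \<Longrightarrow> Id C Y \<cdot> f = f" "Dom C f = X \<Longrightarrow> f \<cdot> Id C X = f"
  using assms Comp_Id_left Comp_Id_right by (auto simp: Hom_iff)

lemma assoc [simp]:
  assumes "f \<in> Arr C" "g \<in> Arr C" "h \<in> Arr C" "Dom C g = Cod C f" "Dom C h = Cod C g"
  shows "(h \<cdot> g) \<cdot> f = h \<cdot> (g \<cdot> f)"
  using assms by (intro Comp_assoc) (auto simp: Hom_iff)

text \<open>Since \<open>assoc\<close> nests composites to the right, an equation for
  \<open>g \<cdot> f\<close> no longer matches once something is composed before f.
  \<open>reassoc\<close> extends it by an arbitrary x on the right, the form in which it applies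
  inside a chain.\<close>

lemma reassoc:
  assumes "g \<cdot> f = k" "f \<in> Arr C" "g \<in> Arr C" "Dom C g = Cod C f"
    "x \<in> Arr C" "Cod C x = Dom C f"
  shows "g \<cdot> (f \<cdot> x) = k \<cdot> x"
  using assms(2-6) by (simp flip: assms(1))

lemma inverse_arrows_unique:
  assumes "inverse_arrows C f g" "inverse_arrows C f h"
  shows "g = h"
proof -
  have "(g \<cdot> f) \<cdot> h = g \<cdot> (f \<cdot> h)"
    using assms by (intro assoc) (auto simp: inverse_arrows_def Hom_iff)
  then show ?thesis
    using assms by (auto simp: inverse_arrows_def Hom_iff)
qed

lemma inv_arr_eqI:
  assumes "inverse_arrows C f g"
  shows "inv_arr C f = g"
  unfolding inv_arr_def using assms inverse_arrows_unique by blast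

lemma is_isoI:
  assumes "inverse_arrows C f g"
  shows "is_iso C f"
  using assms by (auto simp: is_iso_def)

lemma inverse_arrows_inv_arr:
  assumes "is_iso C f"
  shows "inverse_arrows C f (inv_arr C f)"
  using assms inv_arr_eqI by (auto simp: is_iso_def)

lemma is_iso_Arr: "is_iso C f \<Longrightarrow> f \<in> Arr C"
  by (auto simp: is_iso_def inverse_arrows_def)

lemma inv_arr_simps [simp]:
  assumes "is_iso C f"
  shows "inv_arr C f \<in> Arr C" "Dom C (inv_arr C f) = Cod C f" "Cod C (inv_arr C f) = Dom C f"
    "inv_arr C f \<cdot> f = Id C (Dom C f)" "f \<cdot> inv_arr C f = Id C (Cod C f)"
  using inverse_arrows_inv_arr[OF assms] by (auto simp: inverse_arrows_def Hom_iff)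

lemma inv_arr_cancel [simp]:
  assumes "is_iso C f" "x \<in> Arr C"
  shows "Cod C x = Dom C f \<Longrightarrow> inv_arr C f \<cdot> (f \<cdot> x) = x"
    "Cod C x = Cod C f \<Longrightarrow> f \<cdot> (inv_arr C f \<cdot> x) = x"
  using assms by (simp_all add: is_iso_Arr reassoc[OF inv_arr_simps(4)] reassoc[OF inv_arr_simps(5)])

lemma iso_cancel_right:
  assumes "f \<cdot> u = g \<cdot> u" "is_iso C u" "f \<in> Arr C" "g \<in> Arr C"
    "Dom C f = Cod C u" "Dom C g = Cod C u"
  shows "f = g"
proof -
  have "(f \<cdot> u) \<cdot> inv_arr C u = (g \<cdot> u) \<cdot> inv_arr C u"
    using assms by simp
  then show ?thesis
    using assms(2-6) by (simp add: is_iso_Arr)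
qed

lemma iso_cancel_left:
  assumes "u \<cdot> f = u \<cdot> g" "is_iso C u" "f \<in> Arr C" "g \<in> Arr C"
    "Cod C f = Dom C u" "Cod C g = Dom C u"
  shows "f = g"
proof -
  have "inv_arr C u \<cdot> (u \<cdot> f) = inv_arr C u \<cdot> (u \<cdot> g)"
    using assms(1) by simp
  then show ?thesis
    using assms(2-6) by (simp add: is_iso_Arr)
qed

text \<open>Turns a commuting square around along two invertible opposite sides. Naturality of the
  inverse associators and unitors and the multiplication laws of inverse homomorphisms come from
  it.\<close>

lemma natural_inv_arr:
  assumes "v \<cdot> x = y \<cdot> u" "is_iso C u" "is_iso C v" "x \<in> Arr C" "y \<in> Arr C"
    "Dom C x = Dom C u" "Cod C x = Dom C v" "Dom C y = Cod C u" "Cod C y = Cod C v"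
  shows "x \<cdot> inv_arr C u = inv_arr C v \<cdot> y"
proof -
  have "v \<cdot> (x \<cdot> inv_arr C u) = y"
    using assms by (simp add: is_iso_Arr reassoc[OF assms(1)])
  then show ?thesis
    using assms inv_arr_cancel(1)[of v "x \<cdot> inv_arr C u"] by (simp add: is_iso_Arr)
qed

lemma is_iso_Id [simp]: "A \<in> Obj C \<Longrightarrow> is_iso C (Id C A)"
  by (rule is_isoI[of _ "Id C A"]) (simp add: inverse_arrows_def Hom_iff)

lemma inv_arr_Id [simp]: "A \<in> Obj C \<Longrightarrow> inv_arr C (Id C A) = Id C A"
  by (rule inv_arr_eqI) (simp add: inverse_arrows_def Hom_iff)

lemma iso_Comp:
  assumes "is_iso C f" "is_iso C g" "Dom C g = Cod C f"
  shows is_iso_Comp: "is_iso C (g \<cdot> f)"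
    and inv_arr_Comp: "inv_arr C (g \<cdot> f) = inv_arr C f \<cdot> inv_arr C g"
proof -
  have "inverse_arrows C (g \<cdot> f) (inv_arr C f \<cdot> inv_arr C g)"
    using assms by (simp add: inverse_arrows_def Hom_iff is_iso_Arr)
  then show "is_iso C (g \<cdot> f)" "inv_arr C (g \<cdot> f) = inv_arr C f \<cdot> inv_arr C g"
    by (auto intro: is_isoI inv_arr_eqI)
qed

end

section \<open>Coherence for the unitors\<close>

context monoidal_category
begin

lemma Obj_simps [simp]:
  "A \<in> Obj C \<Longrightarrow> B \<in> Obj C \<Longrightarrow> A \<otimes> B \<in> Obj C" "UnitObj C \<in> Obj C"
  by (simp_all add: TensorObj_in_Obj UnitObj_in_Obj)

lemma Tensor_simps [simp]:
  assumes "f \<in> Arr C" "g \<in> Arr C"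
  shows "f \<boxtimes> g \<in> Arr C" "Dom C (f \<boxtimes> g) = Dom C f \<otimes> Dom C g"
    "Cod C (f \<boxtimes> g) = Cod C f \<otimes> Cod C g"
  using TensorArr_in_Hom[of f "Dom C f" "Cod C f" g "Dom C g" "Cod C g"] assms
  by (auto simp: Hom_iff)

declare Tensor_Id [simp]

lemma interchange:
  assumes "f \<in> Arr C" "f' \<in> Arr C" "g \<in> Arr C" "g' \<in> Arr C"
    "Dom C f' = Cod C f" "Dom C g' = Cod C g"
  shows "(f' \<boxtimes> g') \<cdot> (f \<boxtimes> g) = (f' \<cdot> f) \<boxtimes> (g' \<cdot> g)"
  using assms by (intro Tensor_Comp[symmetric]) (auto simp: Hom_iff)

lemma interchange_assoc:
  assumes "f \<in> Arr C" "f' \<in> Arr C" "g \<in> Arr C" "g' \<in> Arr C"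
    "Dom C f' = Cod C f" "Dom C g' = Cod C g" "x \<in> Arr C" "Cod C x = Dom C f \<otimes> Dom C g"
  shows "(f' \<boxtimes> g') \<cdot> ((f \<boxtimes> g) \<cdot> x) = ((f' \<cdot> f) \<boxtimes> (g' \<cdot> g)) \<cdot> x"
  using assms by (simp add: reassoc[OF interchange])

lemma Assoc_simps [simp]:
  assumes "X \<in> Obj C" "Y \<in> Obj C" "Z \<in> Obj C"
  shows "is_iso C (Assoc C X Y Z)" "Assoc C X Y Z \<in> Arr C"
    "Dom C (Assoc C X Y Z) = X \<otimes> (Y \<otimes> Z)" "Cod C (Assoc C X Y Z) = (X \<otimes> Y) \<otimes> Z"
  using Assoc_in_Hom[OF assms] Assoc_iso[OF assms] by (auto simp: Hom_iff)

lemma LUnitor_simps [simp]: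
  assumes "A \<in> Obj C"
  shows "is_iso C (LUnitor C A)" "LUnitor C A \<in> Arr C"
    "Dom C (LUnitor C A) = UnitObj C \<otimes> A" "Cod C (LUnitor C A) = A"
  using LUnitor_in_Hom[OF assms] LUnitor_iso[OF assms] by (auto simp: Hom_iff)

lemma RUnitor_simps [simp]:
  assumes "A \<in> Obj C"
  shows "is_iso C (RUnitor C A)" "RUnitor C A \<in> Arr C"
    "Dom C (RUnitor C A) = A \<otimes> UnitObj C" "Cod C (RUnitor C A) = A"
  using RUnitor_in_Hom[OF assms] RUnitor_iso[OF assms] by (auto simp: Hom_iff)

lemma Assoc_nat:
  assumes "f \<in> Arr C" "g \<in> Arr C" "h \<in> Arr C"
  shows "Assoc C (Cod C f) (Cod C g) (Cod C h) \<cdot> (f \<boxtimes> (g \<boxtimes> h)) =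
    ((f \<boxtimes> g) \<boxtimes> h) \<cdot> Assoc C (Dom C f) (Dom C g) (Dom C h)"
  using assms by (intro Assoc_natural) (auto simp: Hom_iff)

lemma Assoc_inv_nat:
  assumes "f \<in> Arr C" "g \<in> Arr C" "h \<in> Arr C"
  shows "inv_arr C (Assoc C (Cod C f) (Cod C g) (Cod C h)) \<cdot> ((f \<boxtimes> g) \<boxtimes> h) =
    (f \<boxtimes> (g \<boxtimes> h)) \<cdot> inv_arr C (Assoc C (Dom C f) (Dom C g) (Dom C h))"
  using assms by (intro natural_inv_arr[symmetric] Assoc_nat) auto

lemma LUnitor_nat:
  assumes "f \<in> Arr C"
  shows "LUnitor C (Cod C f) \<cdot> (Id C (UnitObj C) \<boxtimes> f) = f \<cdot> LUnitor C (Dom C f)"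
  using assms by (intro LUnitor_natural) (auto simp: Hom_iff)

lemma RUnitor_nat:
  assumes "f \<in> Arr C"
  shows "RUnitor C (Cod C f) \<cdot> (f \<boxtimes> Id C (UnitObj C)) = f \<cdot> RUnitor C (Dom C f)"
  using assms by (intro RUnitor_natural) (auto simp: Hom_iff)

lemma RUnitor_inv_nat:
  assumes "f \<in> Arr C"
  shows "inv_arr C (RUnitor C (Cod C f)) \<cdot> f =
    (f \<boxtimes> Id C (UnitObj C)) \<cdot> inv_arr C (RUnitor C (Dom C f))"
  using assms by (intro natural_inv_arr[symmetric] RUnitor_nat) auto

lemma LUnitor_inv_nat:
  assumes "f \<in> Arr C"
  shows "inv_arr C (LUnitor C (Cod C f)) \<cdot> f =
    (Id C (UnitObj C) \<boxtimes> f) \<cdot> inv_arr C (LUnitor C (Dom C f))"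
  using assms by (intro natural_inv_arr[symmetric] LUnitor_nat) auto

lemma iso_Tensor:
  assumes "is_iso C f" "is_iso C g"
  shows is_iso_Tensor: "is_iso C (f \<boxtimes> g)"
    and inv_arr_Tensor: "inv_arr C (f \<boxtimes> g) = inv_arr C f \<boxtimes> inv_arr C g"
proof -
  have "inverse_arrows C (f \<boxtimes> g) (inv_arr C f \<boxtimes> inv_arr C g)"
    using assms by (simp add: inverse_arrows_def Hom_iff is_iso_Arr interchange)
  then show "is_iso C (f \<boxtimes> g)" "inv_arr C (f \<boxtimes> g) = inv_arr C f \<boxtimes> inv_arr C g"
    by (auto intro: is_isoI inv_arr_eqI)
qed

text \<open>By naturality of the left unitor, id \<otimes> f determines f \<cdot> \<lambda>, and
  \<lambda> can be cancelled. With its mirror image this permits Kelly's argument: an equation may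
  be proved after tensoring with I.\<close>

lemma tensor_unit_left_faithful:
  assumes "Id C (UnitObj C) \<boxtimes> f = Id C (UnitObj C) \<boxtimes> g" "f \<in> Arr C" "g \<in> Arr C"
    "Dom C f = Dom C g" "Cod C f = Cod C g"
  shows "f = g"
  using assms LUnitor_nat[of f] LUnitor_nat[of g]
  by (intro iso_cancel_right[of f "LUnitor C (Dom C f)" g]) auto

lemma tensor_unit_right_faithful:
  assumes "f \<boxtimes> Id C (UnitObj C) = g \<boxtimes> Id C (UnitObj C)" "f \<in> Arr C" "g \<in> Arr C"
    "Dom C f = Dom C g" "Cod C f = Cod C g"
  shows "f = g"
  using assms RUnitor_nat[of f] RUnitor_nat[of g]
  by (intro iso_cancel_right[of f "RUnitor C (Dom C f)" g]) auto

text \<open>Kelly's consequence of the pentagon and the triangle. After tensoring with I on the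
  right, the pentagon for A, B, I, I becomes available, and the triangle relates the right unitors
  to \<lambda> at I.\<close>

lemma RUnitor_tensor:
  assumes A: "A \<in> Obj C" and B: "B \<in> Obj C"
  shows "RUnitor C (A \<otimes> B) \<cdot> Assoc C A B (UnitObj C) = Id C A \<boxtimes> RUnitor C B"
proof (rule tensor_unit_right_faithful)
  let ?I = "UnitObj C"
  \<comment> \<open>The rest of the long side of that pentagon once the associator of A, B, I has
    been split off; it is invertible and is cancelled at the end.\<close>
  let ?u = "Assoc C A (B \<otimes> ?I) ?I \<cdot> (Id C A \<boxtimes> Assoc C B ?I ?I)"
  have "((RUnitor C (A \<otimes> B) \<cdot> Assoc C A B ?I) \<boxtimes> Id C ?I) \<cdot> ?u
      = (RUnitor C (A \<otimes> B) \<boxtimes> Id C ?I) \<cdot> ((Assoc C A B ?I \<boxtimes> Id C ?I) \<cdot> ?u)"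
    using A B by (simp add: interchange_assoc)
  also have "\<dots> = (RUnitor C (A \<otimes> B) \<boxtimes> Id C ?I) \<cdot> (Assoc C (A \<otimes> B) ?I ?I \<cdot> Assoc C A B (?I \<otimes> ?I))"
    using A B by (subst pentagon) auto
  also have "\<dots> = (Id C (A \<otimes> B) \<boxtimes> LUnitor C ?I) \<cdot> Assoc C A B (?I \<otimes> ?I)"
    using A B by (subst reassoc[OF triangle]) auto
  also have "\<dots> = Assoc C A B ?I \<cdot> (Id C A \<boxtimes> (Id C B \<boxtimes> LUnitor C ?I))"
    using A B Assoc_nat[of "Id C A" "Id C B" "LUnitor C ?I"] by simp
  also have "\<dots> = Assoc C A B ?I \<cdot> ((Id C A \<boxtimes> (RUnitor C B \<boxtimes> Id C ?I)) \<cdot> (Id C A \<boxtimes> Assoc C B ?I ?I))"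
    using A B by (simp add: triangle interchange)
  also have "\<dots> = ((Id C A \<boxtimes> RUnitor C B) \<boxtimes> Id C ?I) \<cdot> ?u"
    using A B reassoc[OF Assoc_nat[of "Id C A" "RUnitor C B" "Id C ?I"]] by simp
  finally show "(RUnitor C (A \<otimes> B) \<cdot> Assoc C A B ?I) \<boxtimes> Id C ?I = (Id C A \<boxtimes> RUnitor C B) \<boxtimes> Id C ?I"
    by (rule iso_cancel_right) (use A B in \<open>auto intro!: is_iso_Comp is_iso_Tensor\<close>)
qed (use A B in auto)

text \<open>Mirror image of the previous argument, with the pentagon for I, I, A, B. The two sides
  are compared after a further associator on the left, which is what lets naturality bring the
  pentagon into view.\<close>

lemma LUnitor_tensor:
  assumes A: "A \<in> Obj C" and B: "B \<in> Obj C"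
  shows "(LUnitor C A \<boxtimes> Id C B) \<cdot> Assoc C (UnitObj C) A B = LUnitor C (A \<otimes> B)"
proof (rule tensor_unit_left_faithful[OF iso_cancel_left])
  let ?I = "UnitObj C"
  have "Assoc C ?I A B \<cdot> (Id C ?I \<boxtimes> ((LUnitor C A \<boxtimes> Id C B) \<cdot> Assoc C ?I A B))
      = Assoc C ?I A B \<cdot> ((Id C ?I \<boxtimes> (LUnitor C A \<boxtimes> Id C B)) \<cdot> (Id C ?I \<boxtimes> Assoc C ?I A B))"
    using A B by (simp add: interchange)
  also have "\<dots> = ((Id C ?I \<boxtimes> LUnitor C A) \<boxtimes> Id C B) \<cdot>
      (Assoc C ?I (?I \<otimes> A) B \<cdot> (Id C ?I \<boxtimes> Assoc C ?I A B))"
    using A B reassoc[OF Assoc_nat[of "Id C ?I" "LUnitor C A" "Id C B"]] by simp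
  also have "\<dots> = ((RUnitor C ?I \<boxtimes> Id C A) \<boxtimes> Id C B) \<cdot> ((Assoc C ?I ?I A \<boxtimes> Id C B) \<cdot>
      (Assoc C ?I (?I \<otimes> A) B \<cdot> (Id C ?I \<boxtimes> Assoc C ?I A B)))"
    using A B by (simp add: triangle interchange_assoc)
  also have "\<dots> = ((RUnitor C ?I \<boxtimes> Id C A) \<boxtimes> Id C B) \<cdot> (Assoc C (?I \<otimes> ?I) A B \<cdot> Assoc C ?I ?I (A \<otimes> B))"
    using A B by (subst pentagon) auto
  also have "\<dots> = Assoc C ?I A B \<cdot> ((RUnitor C ?I \<boxtimes> Id C (A \<otimes> B)) \<cdot> Assoc C ?I ?I (A \<otimes> B))"
    using A B reassoc[OF Assoc_nat[of "RUnitor C ?I" "Id C A" "Id C B", symmetric]] by simp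
  also have "\<dots> = Assoc C ?I A B \<cdot> (Id C ?I \<boxtimes> LUnitor C (A \<otimes> B))"
    using A B by (simp add: triangle interchange)
  finally show "Assoc C ?I A B \<cdot> (Id C ?I \<boxtimes> ((LUnitor C A \<boxtimes> Id C B) \<cdot> Assoc C ?I A B)) =
      Assoc C ?I A B \<cdot> (Id C ?I \<boxtimes> LUnitor C (A \<otimes> B))" .
qed (use A B in auto)

text \<open>Naturality of \<lambda> at its own component at I identifies \<lambda> at I \<otimes> I
  with id \<otimes> \<lambda>. The formula for \<lambda> at a tensor product and the triangle then
  make both unitors agree after tensoring with I.\<close>

lemma LUnitor_UnitObj: "LUnitor C (UnitObj C) = RUnitor C (UnitObj C)"
proof (rule tensor_unit_right_faithful)
  let ?I = "UnitObj C"
  have "LUnitor C (?I \<otimes> ?I) = Id C ?I \<boxtimes> LUnitor C ?I"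
    using LUnitor_nat[of "LUnitor C ?I"] by (intro iso_cancel_left[of "LUnitor C ?I" "LUnitor C (?I \<otimes> ?I)"]) auto
  then have "(LUnitor C ?I \<boxtimes> Id C ?I) \<cdot> Assoc C ?I ?I ?I = (RUnitor C ?I \<boxtimes> Id C ?I) \<cdot> Assoc C ?I ?I ?I"
    by (simp add: LUnitor_tensor triangle)
  then show "LUnitor C ?I \<boxtimes> Id C ?I = RUnitor C ?I \<boxtimes> Id C ?I"
    by (rule iso_cancel_right) auto
qed auto

text \<open>All five edges reversed: the form needed for associativity of the multiplication of -
  \<otimes> B.\<close>

lemma pentagon_inv:
  assumes "W \<in> Obj C" "X \<in> Obj C" "Y \<in> Obj C" "Z \<in> Obj C"
  shows "inv_arr C (Assoc C W X (Y \<otimes> Z)) \<cdot> inv_arr C (Assoc C (W \<otimes> X) Y Z) =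
    (Id C W \<boxtimes> inv_arr C (Assoc C X Y Z)) \<cdot>
      (inv_arr C (Assoc C W (X \<otimes> Y) Z) \<cdot> (inv_arr C (Assoc C W X Y) \<boxtimes> Id C Z))"
  using arg_cong[OF pentagon[OF assms], of "inv_arr C"] assms
  by (simp add: inv_arr_Comp inv_arr_Tensor is_iso_Comp is_iso_Tensor)

text \<open>The partly reversed form that makes \<alpha>, as a strength, compatible with the
  multiplication of - \<otimes> B.\<close>

lemma pentagon_inv_right:
  assumes "W \<in> Obj C" "X \<in> Obj C" "Y \<in> Obj C" "Z \<in> Obj C"
  shows "Assoc C W X (Y \<otimes> Z) \<cdot> (Id C W \<boxtimes> inv_arr C (Assoc C X Y Z)) =
    inv_arr C (Assoc C (W \<otimes> X) Y Z) \<cdot> ((Assoc C W X Y \<boxtimes> Id C Z) \<cdot> Assoc C W (X \<otimes> Y) Z)"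
proof -
  have "Assoc C W X (Y \<otimes> Z) \<cdot> inv_arr C (Id C W \<boxtimes> Assoc C X Y Z) =
    inv_arr C (Assoc C (W \<otimes> X) Y Z) \<cdot> ((Assoc C W X Y \<boxtimes> Id C Z) \<cdot> Assoc C W (X \<otimes> Y) Z)"
    using assms by (intro natural_inv_arr) (simp_all add: pentagon is_iso_Tensor)
  then show ?thesis
    using assms by (simp add: inv_arr_Tensor)
qed

text \<open>The partly reversed form that arises in the Frobenius law of - \<otimes> B.\<close>

lemma pentagon_inv_left:
  assumes "W \<in> Obj C" "X \<in> Obj C" "Y \<in> Obj C" "Z \<in> Obj C"
  shows "(inv_arr C (Assoc C W X Y) \<boxtimes> Id C Z) \<cdot> Assoc C (W \<otimes> X) Y Z =
    Assoc C W (X \<otimes> Y) Z \<cdot> ((Id C W \<boxtimes> Assoc C X Y Z) \<cdot> inv_arr C (Assoc C W X (Y \<otimes> Z)))"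
proof -
  have "(Assoc C W (X \<otimes> Y) Z \<cdot> (Id C W \<boxtimes> Assoc C X Y Z)) \<cdot> inv_arr C (Assoc C W X (Y \<otimes> Z)) =
    inv_arr C (Assoc C W X Y \<boxtimes> Id C Z) \<cdot> Assoc C (W \<otimes> X) Y Z"
    using assms by (intro natural_inv_arr) (simp_all add: pentagon is_iso_Tensor)
  then show ?thesis
    using assms by (simp add: inv_arr_Tensor)
qed

lemma RUnitor_tensor_inv:
  assumes "A \<in> Obj C" "B \<in> Obj C"
  shows "Assoc C A B (UnitObj C) \<cdot> (Id C A \<boxtimes> inv_arr C (RUnitor C B)) =
    inv_arr C (RUnitor C (A \<otimes> B))"
proof -
  have "Assoc C A B (UnitObj C) \<cdot> inv_arr C (Id C A \<boxtimes> RUnitor C B) =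
    inv_arr C (RUnitor C (A \<otimes> B)) \<cdot> Id C (A \<otimes> B)"
    using assms by (intro natural_inv_arr) (simp_all add: RUnitor_tensor is_iso_Tensor)
  then show ?thesis
    using assms by (simp add: inv_arr_Tensor)
qed

end

section \<open>Daggers and unitary morphisms\<close>

context dagger_category
begin

lemma dag_simps [simp]:
  assumes "f \<in> Arr C"
  shows "dag f \<in> Arr C" "Dom C (dag f) = Cod C f" "Cod C (dag f) = Dom C f" "dag (dag f) = f"
  using dag_in_Hom[of f "Dom C f" "Cod C f"] assms dag_dag by (auto simp: Hom_iff)

declare dag_Id [simp]

lemma dag_Comp' [simp]:
  assumes "f \<in> Arr C" "g \<in> Arr C" "Dom C g = Cod C f"
  shows "dag (g \<cdot> f) = dag f \<cdot> dag g"
  using assms by (intro dag_Comp) (auto simp: Hom_iff)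

lemma unitary_simps:
  assumes "unitary C dag f"
  shows "inv_arr C f = dag f" "is_iso C f"
  using assms by (auto simp: unitary_def intro: inv_arr_eqI is_isoI)

lemma unitaryI:
  assumes "is_iso C f" "inv_arr C f = dag f"
  shows "unitary C dag f"
  using inverse_arrows_inv_arr[OF assms(1)] assms(2) by (simp add: unitary_def)

end

context monoidal_dagger_category
begin

declare dag_Tensor [simp]

text \<open>Kept out of the simp set: calculations run on inverses, which have cancellation rules,
  and the translation is made only where a dagger has to be evaluated.\<close>

lemma inv_arr_dag:
  "X \<in> Obj C \<Longrightarrow> Y \<in> Obj C \<Longrightarrow> Z \<in> Obj C \<Longrightarrow> inv_arr C (Assoc C X Y Z) = Dag C (Assoc C X Y Z)"
  "A \<in> Obj C \<Longrightarrow> inv_arr C (LUnitor C A) = Dag C (LUnitor C A)"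
  "A \<in> Obj C \<Longrightarrow> inv_arr C (RUnitor C A) = Dag C (RUnitor C A)"
  by (simp_all add: unitary_simps Assoc_unitary LUnitor_unitary RUnitor_unitary)

lemma dag_inv_Assoc [simp]:
  "X \<in> Obj C \<Longrightarrow> Y \<in> Obj C \<Longrightarrow> Z \<in> Obj C \<Longrightarrow> Dag C (inv_arr C (Assoc C X Y Z)) = Assoc C X Y Z"
  by (simp add: inv_arr_dag)

end

section \<open>Functors and natural transformations\<close>

lemma is_functor_Obj:
  assumes "is_functor C D F" "A \<in> Obj C"
  shows "OnObj F A \<in> Obj D"
  using assms by (auto simp: is_functor_def)

lemma is_functor_Arr:
  assumes "is_functor C D F" "f \<in> Arr C"
  shows "OnArr F f \<in> Arr D" "Dom D (OnArr F f) = OnObj F (Dom C f)"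
    "Cod D (OnArr F f) = OnObj F (Cod C f)"
  using assms by (auto simp: is_functor_def Hom_def)

lemma is_functor_Id:
  assumes "is_functor C D F" "A \<in> Obj C"
  shows "OnArr F (Id C A) = Id D (OnObj F A)"
  using assms by (auto simp: is_functor_def)

lemma is_functor_Comp:
  assumes "is_functor C D F" "f \<in> Arr C" "g \<in> Arr C" "Dom C g = Cod C f"
  shows "OnArr F (g \<cdot>\<^bsub>C\<^esub> f) = OnArr F g \<cdot>\<^bsub>D\<^esub> OnArr F f"
  using assms unfolding is_functor_def Hom_def by blast

lemma is_functorI:
  assumes "category C" "category D" "OnObj F \<in> extensional (Obj C)" "OnArr F \<in> extensional (Arr C)"
    "\<And>A. A \<in> Obj C \<Longrightarrow> OnObj F A \<in> Obj D \<and> OnArr F (Id C A) = Id D (OnObj F A)"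
    "\<And>f. f \<in> Arr C \<Longrightarrow> OnArr F f \<in> Arr D \<and> Dom D (OnArr F f) = OnObj F (Dom C f) \<and>
       Cod D (OnArr F f) = OnObj F (Cod C f)"
    "\<And>f g. f \<in> Arr C \<Longrightarrow> g \<in> Arr C \<Longrightarrow> Dom C g = Cod C f \<Longrightarrow>
       OnArr F (g \<cdot>\<^bsub>C\<^esub> f) = OnArr F g \<cdot>\<^bsub>D\<^esub> OnArr F f"
  shows "is_functor C D F"
  using assms by (auto simp: is_functor_def Hom_def PiE_def)

lemma id_functor_simps [simp]:
  "A \<in> Obj C \<Longrightarrow> OnObj (id_functor C) A = A"
  "f \<in> Arr C \<Longrightarrow> OnArr (id_functor C) f = f"
  by (simp_all add: id_functor_def)

lemma comp_functor_simps [simp]: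
  "A \<in> Obj C \<Longrightarrow> OnObj (comp_functor C G F) A = OnObj G (OnObj F A)"
  "f \<in> Arr C \<Longrightarrow> OnArr (comp_functor C G F) f = OnArr G (OnArr F f)"
  by (simp_all add: comp_functor_def)

lemma (in category) id_functor_is_functor: "is_functor C C (id_functor C)"
  unfolding is_functor_def using category_axioms by (auto simp: id_functor_def Hom_iff)

lemma comp_functor_is_functor:
  assumes F: "is_functor C D F" and G: "is_functor D E G"
  shows "is_functor C E (comp_functor C G F)"
proof -
  interpret C: category C using F by (simp add: is_functor_def)
  have "category E" using G by (simp add: is_functor_def)
  then show ?thesis
    unfolding is_functor_def
    using C.category_axioms is_functor_Obj[OF F] is_functor_Obj[OF G] is_functor_Arr[OF F]
      is_functor_Arr[OF G] is_functor_Id[OF F] is_functor_Id[OF G] is_functor_Comp[OF F]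
      is_functor_Comp[OF G]
    by (auto simp: comp_functor_def Hom_def)
qed

lemma natural_transformation_simps:
  assumes "natural_transformation C D F G \<tau>" "A \<in> Obj C"
  shows "\<tau> A \<in> Arr D" "Dom D (\<tau> A) = OnObj F A" "Cod D (\<tau> A) = OnObj G A"
  using assms by (auto simp: natural_transformation_def Hom_def)

lemma natural_transformation_nat:
  assumes "natural_transformation C D F G \<tau>" "f \<in> Arr C"
  shows "\<tau> (Cod C f) \<cdot>\<^bsub>D\<^esub> OnArr F f = OnArr G f \<cdot>\<^bsub>D\<^esub> \<tau> (Dom C f)"
  using assms by (auto simp: natural_transformation_def Hom_def)

lemma natural_transformationI:
  assumes "is_functor C D F" "is_functor C D G" "\<tau> \<in> extensional (Obj C)"
    "\<And>A. A \<in> Obj C \<Longrightarrow> \<tau> A \<in> Arr D \<and> Dom D (\<tau> A) = OnObj F A \<and> Cod D (\<tau> A) = OnObj G A"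
    "\<And>f. f \<in> Arr C \<Longrightarrow> \<tau> (Cod C f) \<cdot>\<^bsub>D\<^esub> OnArr F f = OnArr G f \<cdot>\<^bsub>D\<^esub> \<tau> (Dom C f)"
  shows "natural_transformation C D F G \<tau>"
  using assms by (auto simp: natural_transformation_def Hom_def)

section \<open>The monad of a monoid\<close>

context monoid_object
begin

lemma monoid_simps [simp]:
  "MObj B \<in> Obj C"
  "MMult B \<in> Arr C" "Dom C (MMult B) = MObj B \<otimes> MObj B" "Cod C (MMult B) = MObj B"
  "MUnit B \<in> Arr C" "Dom C (MUnit B) = UnitObj C" "Cod C (MUnit B) = MObj B"
  using MObj_in_Obj MMult_in_Hom MUnit_in_Hom by (auto simp: Hom_iff)

lemma tensor_monad_simps [simp]:
  "A \<in> Obj C \<Longrightarrow> OnObj (tensor_monad C B) A = A \<otimes> MObj B"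
  "f \<in> Arr C \<Longrightarrow> OnArr (tensor_monad C B) f = f \<boxtimes> Id C (MObj B)"
  "A \<in> Obj C \<Longrightarrow> Mu (tensor_monad C B) A =
     (Id C A \<boxtimes> MMult B) \<cdot> inv_arr C (Assoc C A (MObj B) (MObj B))"
  "A \<in> Obj C \<Longrightarrow> Eta (tensor_monad C B) A = (Id C A \<boxtimes> MUnit B) \<cdot> inv_arr C (RUnitor C A)"
  "X \<in> Obj C \<Longrightarrow> Y \<in> Obj C \<Longrightarrow> St (tensor_monad C B) (X, Y) = Assoc C X Y (MObj B)"
  by (simp_all add: tensor_monad_def)

lemma tensor_monad_extensional:
  "Mu (tensor_monad C B) \<in> extensional (Obj C)"
  "Eta (tensor_monad C B) \<in> extensional (Obj C)"
  "St (tensor_monad C B) \<in> extensional (Obj C \<times> Obj C)"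
  by (simp_all add: tensor_monad_def)

lemma tensor_monad_functor: "is_functor C C (tensor_monad C B)"
  unfolding is_functor_def using category_axioms
  by (auto simp: tensor_monad_def Hom_iff interchange)

text \<open>Naturality of the inverse associator brings the two multiplications together, the
  reversed pentagon matches the bracketings, and what remains is associativity of m in the right
  factor.\<close>

lemma tensor_monad_Mu_assoc:
  assumes A: "A \<in> Obj C"
  shows "Mu (tensor_monad C B) A \<cdot> OnArr (tensor_monad C B) (Mu (tensor_monad C B) A) =
    Mu (tensor_monad C B) A \<cdot> Mu (tensor_monad C B) (OnObj (tensor_monad C B) A)"
proof -
  let ?b = "MObj B" and ?m = "MMult B"
  let ?u = "inv_arr C (Assoc C A (?b \<otimes> ?b) ?b) \<cdot> (inv_arr C (Assoc C A ?b ?b) \<boxtimes> Id C ?b)"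
  have m: "?m \<cdot> ((Id C ?b \<boxtimes> ?m) \<cdot> inv_arr C (Assoc C ?b ?b ?b)) = ?m \<cdot> (?m \<boxtimes> Id C ?b)"
    using reassoc[OF MMult_assoc[symmetric], of "inv_arr C (Assoc C ?b ?b ?b)"] by simp
  have "Mu (tensor_monad C B) A \<cdot> OnArr (tensor_monad C B) (Mu (tensor_monad C B) A) =
      (Id C A \<boxtimes> ?m) \<cdot> (inv_arr C (Assoc C A ?b ?b) \<cdot>
        (((Id C A \<boxtimes> ?m) \<boxtimes> Id C ?b) \<cdot> (inv_arr C (Assoc C A ?b ?b) \<boxtimes> Id C ?b)))"
    using A by (simp add: interchange)
  also have "\<dots> = (Id C A \<boxtimes> (?m \<cdot> (?m \<boxtimes> Id C ?b))) \<cdot> ?u"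
    using A reassoc[OF Assoc_inv_nat[of "Id C A" ?m "Id C ?b"]] by (simp add: interchange_assoc)
  also have "\<dots> = (Id C A \<boxtimes> ?m) \<cdot> ((Id C A \<boxtimes> (Id C ?b \<boxtimes> ?m)) \<cdot>
      ((Id C A \<boxtimes> inv_arr C (Assoc C ?b ?b ?b)) \<cdot> ?u))"
    using A by (simp add: interchange_assoc m)
  also have "\<dots> = (Id C A \<boxtimes> ?m) \<cdot> ((Id C A \<boxtimes> (Id C ?b \<boxtimes> ?m)) \<cdot>
      (inv_arr C (Assoc C A ?b (?b \<otimes> ?b)) \<cdot> inv_arr C (Assoc C (A \<otimes> ?b) ?b ?b)))"
    using A by (simp add: pentagon_inv)
  also have "\<dots> = Mu (tensor_monad C B) A \<cdot> Mu (tensor_monad C B) (OnObj (tensor_monad C B) A)"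
    using A reassoc[OF Assoc_inv_nat[of "Id C A" "Id C ?b" ?m]] by simp
  finally show ?thesis .
qed

lemma tensor_monad_monad: "monad C (tensor_monad C B)"
proof
  let ?b = "MObj B" and ?m = "MMult B" and ?e = "MUnit B" and ?T = "tensor_monad C B"
  show "is_functor C C ?T" by (rule tensor_monad_functor)
  show "natural_transformation C C (comp_functor C ?T ?T) ?T (Mu ?T)"
  proof (rule natural_transformationI)
    fix f assume "f \<in> Arr C"
    then show "Mu ?T (Cod C f) \<cdot> OnArr (comp_functor C ?T ?T) f = OnArr ?T f \<cdot> Mu ?T (Dom C f)"
      using Assoc_inv_nat[of f "Id C ?b" "Id C ?b"] by (simp add: interchange_assoc)
  qed (simp_all add: tensor_monad_functor tensor_monad_extensional
      comp_functor_is_functor[OF tensor_monad_functor])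
  show "natural_transformation C C (id_functor C) ?T (Eta ?T)"
  proof (rule natural_transformationI)
    fix f assume "f \<in> Arr C"
    then show "Eta ?T (Cod C f) \<cdot> OnArr (id_functor C) f = OnArr ?T f \<cdot> Eta ?T (Dom C f)"
      using RUnitor_inv_nat[of f] by (simp add: interchange_assoc)
  qed (simp_all add: tensor_monad_functor id_functor_is_functor tensor_monad_extensional)
  fix A assume A: "A \<in> Obj C"
  show "Mu ?T A \<cdot> OnArr ?T (Mu ?T A) = Mu ?T A \<cdot> Mu ?T (OnObj ?T A)"
    using A by (rule tensor_monad_Mu_assoc)
  \<comment> \<open>The unit of the monad at A \<otimes> B inserts e to the right of B, so the right
    unit law of the monoid is the one used here. In the other law, T applied to the unit at A
    inserts e to the left of B.\<close>
  have "Mu ?T A \<cdot> Eta ?T (OnObj ?T A) = (Id C A \<boxtimes> ?m) \<cdot> ((Id C A \<boxtimes> (Id C ?b \<boxtimes> ?e)) \<cdot>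
      (inv_arr C (Assoc C A ?b (UnitObj C)) \<cdot> inv_arr C (RUnitor C (A \<otimes> ?b))))"
    using A reassoc[OF Assoc_inv_nat[of "Id C A" "Id C ?b" ?e]] by simp
  also have "\<dots> = (Id C A \<boxtimes> RUnitor C ?b) \<cdot> (Id C A \<boxtimes> inv_arr C (RUnitor C ?b))"
    using A by (simp add: interchange_assoc MUnit_right flip: RUnitor_tensor_inv)
  also have "\<dots> = Id C (OnObj ?T A)"
    using A by (simp add: interchange)
  finally show "Mu ?T A \<cdot> Eta ?T (OnObj ?T A) = Id C (OnObj ?T A)" .
  have "Mu ?T A \<cdot> OnArr ?T (Eta ?T A) = (Id C A \<boxtimes> ?m) \<cdot> (inv_arr C (Assoc C A ?b ?b) \<cdot>
      (((Id C A \<boxtimes> ?e) \<boxtimes> Id C ?b) \<cdot> (inv_arr C (RUnitor C A) \<boxtimes> Id C ?b)))"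
    using A by (simp add: interchange)
  also have "\<dots> = (Id C A \<boxtimes> ?m) \<cdot> ((Id C A \<boxtimes> (?e \<boxtimes> Id C ?b)) \<cdot>
      (inv_arr C (Assoc C A (UnitObj C) ?b) \<cdot> (inv_arr C (RUnitor C A) \<boxtimes> Id C ?b)))"
    using A reassoc[OF Assoc_inv_nat[of "Id C A" ?e "Id C ?b"]] by simp
  also have "\<dots> = ((RUnitor C A \<boxtimes> Id C ?b) \<cdot> Assoc C A (UnitObj C) ?b) \<cdot>
      (inv_arr C (Assoc C A (UnitObj C) ?b) \<cdot> (inv_arr C (RUnitor C A) \<boxtimes> Id C ?b))"
    using A by (subst triangle) (simp_all add: interchange_assoc MUnit_left)
  also have "\<dots> = Id C (OnObj ?T A)"
    using A by (simp add: interchange)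
  finally show "Mu ?T A \<cdot> OnArr ?T (Eta ?T A) = Id C (OnObj ?T A)" .
qed

text \<open>With \<alpha> as strength, the associator law is the pentagon, the unitor law is
  \<open>LUnitor_tensor\<close>, the multiplication law is a partly reversed pentagon, and the unit
  law is \<open>RUnitor_tensor_inv\<close>.\<close>

lemma tensor_monad_strong: "strong_monad C (tensor_monad C B)"
proof -
  let ?b = "MObj B" and ?m = "MMult B" and ?e = "MUnit B" and ?T = "tensor_monad C B"
  interpret T: monad C ?T by (rule tensor_monad_monad)
  show ?thesis
  proof
    show "St ?T \<in> extensional (Obj C \<times> Obj C)"
      by (rule tensor_monad_extensional)
    fix A X assume A: "A \<in> Obj C" and X: "X \<in> Obj C"
    show "St ?T (A, X) \<in> Hom C (A \<otimes> OnObj ?T X) (OnObj ?T (A \<otimes> X))"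
      using A X by (simp add: Hom_iff)
    have "St ?T (A, X) \<cdot> (Id C A \<boxtimes> Mu ?T X) = Assoc C A X ?b \<cdot>
        ((Id C A \<boxtimes> (Id C X \<boxtimes> ?m)) \<cdot> (Id C A \<boxtimes> inv_arr C (Assoc C X ?b ?b)))"
      using A X by (simp add: interchange)
    also have "\<dots> = (Id C (A \<otimes> X) \<boxtimes> ?m) \<cdot>
        (Assoc C A X (?b \<otimes> ?b) \<cdot> (Id C A \<boxtimes> inv_arr C (Assoc C X ?b ?b)))"
      using A X reassoc[OF Assoc_nat[of "Id C A" "Id C X" ?m]] by simp
    also have "\<dots> = Mu ?T (A \<otimes> X) \<cdot> (OnArr ?T (St ?T (A, X)) \<cdot> St ?T (A, OnObj ?T X))"
      using A X by (simp add: pentagon_inv_right)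
    finally show "St ?T (A, X) \<cdot> (Id C A \<boxtimes> Mu ?T X) =
        Mu ?T (A \<otimes> X) \<cdot> (OnArr ?T (St ?T (A, X)) \<cdot> St ?T (A, OnObj ?T X))" .
    have "St ?T (A, X) \<cdot> (Id C A \<boxtimes> Eta ?T X) = Assoc C A X ?b \<cdot>
        ((Id C A \<boxtimes> (Id C X \<boxtimes> ?e)) \<cdot> (Id C A \<boxtimes> inv_arr C (RUnitor C X)))"
      using A X by (simp add: interchange)
    also have "\<dots> = Eta ?T (A \<otimes> X)"
      using A X reassoc[OF Assoc_nat[of "Id C A" "Id C X" ?e]] by (simp add: RUnitor_tensor_inv)
    finally show "St ?T (A, X) \<cdot> (Id C A \<boxtimes> Eta ?T X) = Eta ?T (A \<otimes> X)" .
  next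
    fix f A A' g X X' assume "f \<in> Hom C A A'" "g \<in> Hom C X X'"
    then show "St ?T (A', X') \<cdot> (f \<boxtimes> OnArr ?T g) = OnArr ?T (f \<boxtimes> g) \<cdot> St ?T (A, X)"
      using Assoc_nat[of f g "Id C ?b"] by (auto simp: Hom_iff)
  qed (simp_all add: pentagon LUnitor_tensor)
qed

end

text \<open>Up to conjugation by a unitary associator, one side of the law for - \<otimes> B is id
  \<otimes> F, where F, below \<open>?F\<close>, is one side of the Frobenius law of B.\<close>

lemma (in frobenius_monoid) tensor_monad_frobenius:
  "strong_frobenius_monad C (tensor_monad C B)"
proof -
  let ?b = "MObj B" and ?m = "MMult B" and ?T = "tensor_monad C B"
  interpret T: strong_monad C ?T by (rule tensor_monad_strong)
  show ?thesis
  proof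
    show "OnArr ?T (Dag C f) = Dag C (OnArr ?T f)" if "f \<in> Arr C" for f
      using that by simp
    show "unitary C (Dag C) (St ?T (A, X))" if "A \<in> Obj C" "X \<in> Obj C" for A X
      using that by (simp add: Assoc_unitary)
    fix A assume A: "A \<in> Obj C"
    let ?F = "(?m \<boxtimes> Id C ?b) \<cdot> (Assoc C ?b ?b ?b \<cdot> (Id C ?b \<boxtimes> Dag C ?m))"
    \<comment> \<open>Because the associator is unitary, the two sides of the Frobenius law of B are
      daggers of each other; the law therefore says exactly that F is self-adjoint.\<close>
    have F: "Dag C ?F = ?F"
      using frobenius_law by (simp add: inv_arr_dag)
    have "OnArr ?T (Mu ?T A) \<cdot> Dag C (Mu ?T (OnObj ?T A)) =
        ((Id C A \<boxtimes> ?m) \<boxtimes> Id C ?b) \<cdot> ((inv_arr C (Assoc C A ?b ?b) \<boxtimes> Id C ?b) \<cdot>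
          (Assoc C (A \<otimes> ?b) ?b ?b \<cdot> (Id C (A \<otimes> ?b) \<boxtimes> Dag C ?m)))"
      using A by (simp add: interchange_assoc)
    \<comment> \<open>The reversed pentagon produces id \<otimes> \<alpha>, so that after naturality
      everything except two outer associators happens to the right of A.\<close>
    also have "\<dots> = ((Id C A \<boxtimes> ?m) \<boxtimes> Id C ?b) \<cdot> (Assoc C A (?b \<otimes> ?b) ?b \<cdot>
        ((Id C A \<boxtimes> Assoc C ?b ?b ?b) \<cdot> (inv_arr C (Assoc C A ?b (?b \<otimes> ?b)) \<cdot>
          (Id C (A \<otimes> ?b) \<boxtimes> Dag C ?m))))"
      using A reassoc[OF pentagon_inv_left[of A ?b ?b ?b]] by simp
    also have "\<dots> = Assoc C A ?b ?b \<cdot> ((Id C A \<boxtimes> (?m \<boxtimes> Id C ?b)) \<cdot>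
        ((Id C A \<boxtimes> Assoc C ?b ?b ?b) \<cdot> ((Id C A \<boxtimes> (Id C ?b \<boxtimes> Dag C ?m)) \<cdot>
          inv_arr C (Assoc C A ?b ?b))))"
      using A Assoc_inv_nat[of "Id C A" "Id C ?b" "Dag C ?m"]
        reassoc[OF Assoc_nat[of "Id C A" ?m "Id C ?b", symmetric]] by simp
    also have "\<dots> = Assoc C A ?b ?b \<cdot> ((Id C A \<boxtimes> ?F) \<cdot> inv_arr C (Assoc C A ?b ?b))"
      using A by (simp add: interchange_assoc)
    finally have *: "OnArr ?T (Mu ?T A) \<cdot> Dag C (Mu ?T (OnObj ?T A)) =
        Assoc C A ?b ?b \<cdot> ((Id C A \<boxtimes> ?F) \<cdot> inv_arr C (Assoc C A ?b ?b))" .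
    \<comment> \<open>The two sides of the law are adjoint to each other, so it suffices that one is self-adjoint.\<close>
    have "Mu ?T (OnObj ?T A) \<cdot> OnArr ?T (Dag C (Mu ?T A)) =
        Dag C (OnArr ?T (Mu ?T A) \<cdot> Dag C (Mu ?T (OnObj ?T A)))"
      using A by (simp add: inv_arr_dag)
    also have "\<dots> = Dag C (Assoc C A ?b ?b \<cdot> ((Id C A \<boxtimes> ?F) \<cdot> inv_arr C (Assoc C A ?b ?b)))"
      by (simp only: *)
    also have "\<dots> = Assoc C A ?b ?b \<cdot> ((Id C A \<boxtimes> Dag C ?F) \<cdot> inv_arr C (Assoc C A ?b ?b))"
      using A by (simp add: inv_arr_dag)
    finally show "OnArr ?T (Mu ?T A) \<cdot> Dag C (Mu ?T (OnObj ?T A)) =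
        Mu ?T (OnObj ?T A) \<cdot> OnArr ?T (Dag C (Mu ?T A))"
      by (simp only: * F)
  qed
qed

section \<open>The monoid of a strong monad\<close>

context monad
begin

lemma functor_simps [simp]:
  "A \<in> Obj C \<Longrightarrow> OnObj T A \<in> Obj C"
  "f \<in> Arr C \<Longrightarrow> OnArr T f \<in> Arr C"
  "f \<in> Arr C \<Longrightarrow> Dom C (OnArr T f) = OnObj T (Dom C f)"
  "f \<in> Arr C \<Longrightarrow> Cod C (OnArr T f) = OnObj T (Cod C f)"
  "A \<in> Obj C \<Longrightarrow> OnArr T (Id C A) = Id C (OnObj T A)"
  using monad_functor
  by (simp_all add: is_functor_Obj is_functor_Arr is_functor_Id)

lemma functor_Comp [simp]:
  assumes "f \<in> Arr C" "g \<in> Arr C" "Dom C g = Cod C f"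
  shows "OnArr T (g \<cdot> f) = OnArr T g \<cdot> OnArr T f"
  using monad_functor assms by (rule is_functor_Comp)

lemma functor_iso:
  assumes "is_iso C f"
  shows functor_is_iso: "is_iso C (OnArr T f)"
    and functor_inv_arr: "inv_arr C (OnArr T f) = OnArr T (inv_arr C f)"
proof -
  have "inverse_arrows C (OnArr T f) (OnArr T (inv_arr C f))"
    using assms by (simp add: inverse_arrows_def Hom_iff is_iso_Arr flip: functor_Comp)
  then show "is_iso C (OnArr T f)" "inv_arr C (OnArr T f) = OnArr T (inv_arr C f)"
    by (auto intro: is_isoI inv_arr_eqI)
qed

lemma Mu_simps [simp]:
  assumes "A \<in> Obj C"
  shows "Mu T A \<in> Arr C" "Dom C (Mu T A) = OnObj T (OnObj T A)" "Cod C (Mu T A) = OnObj T A"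
  using natural_transformation_simps[OF Mu_natural assms] assms by simp_all

lemma Eta_simps [simp]:
  assumes "A \<in> Obj C"
  shows "Eta T A \<in> Arr C" "Dom C (Eta T A) = A" "Cod C (Eta T A) = OnObj T A"
  using natural_transformation_simps[OF Eta_natural assms] assms by simp_all

lemma Mu_nat:
  assumes "f \<in> Arr C"
  shows "Mu T (Cod C f) \<cdot> OnArr T (OnArr T f) = OnArr T f \<cdot> Mu T (Dom C f)"
  using natural_transformation_nat[OF Mu_natural assms] assms by simp

lemma Eta_nat:
  assumes "f \<in> Arr C"
  shows "Eta T (Cod C f) \<cdot> f = OnArr T f \<cdot> Eta T (Dom C f)"
  using natural_transformation_nat[OF Eta_natural assms] assms by simp

end

section \<open>The comparison A \<otimes> T(I) \<rightarrow> T(A)\<close>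

definition tensor_comparison ::
  "('o, 'm, 'z) mon_cat_scheme \<Rightarrow> ('o, 'm, 'y) str_mnd_scheme \<Rightarrow> 'o \<Rightarrow> 'm"
where
  "tensor_comparison C T A = OnArr T (RUnitor C A) \<cdot>\<^bsub>C\<^esub> St T (A, UnitObj C)"

text \<open>The multiplication is put in terms of \<open>tensor_comparison\<close>, so that
  arguments about the monoid T(I) use the properties of the comparison and not the strength
  directly.\<close>

lemma monoid_of_monad_simps [simp]:
  "MObj (monoid_of_monad C T) = OnObj T (UnitObj C)"
  "MMult (monoid_of_monad C T) =
     Mu T (UnitObj C) \<cdot>\<^bsub>C\<^esub> tensor_comparison C T (OnObj T (UnitObj C))"
  "MUnit (monoid_of_monad C T) = Eta T (UnitObj C)"
  by (simp_all add: monoid_of_monad_def tensor_comparison_def Let_def)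

context strong_monad
begin

lemma St_simps [simp]:
  assumes "A \<in> Obj C" "B \<in> Obj C"
  shows "St T (A, B) \<in> Arr C" "Dom C (St T (A, B)) = A \<otimes> OnObj T B"
    "Cod C (St T (A, B)) = OnObj T (A \<otimes> B)"
  using St_in_Hom[OF assms] by (auto simp: Hom_iff)

lemma St_nat:
  assumes "f \<in> Arr C" "g \<in> Arr C"
  shows "St T (Cod C f, Cod C g) \<cdot> (f \<boxtimes> OnArr T g) =
    OnArr T (f \<boxtimes> g) \<cdot> St T (Dom C f, Dom C g)"
  using assms by (intro St_natural) (auto simp: Hom_iff)

lemma comparison_simps [simp]:
  assumes "A \<in> Obj C"
  shows "tensor_comparison C T A \<in> Arr C"
    "Dom C (tensor_comparison C T A) = A \<otimes> OnObj T (UnitObj C)"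
    "Cod C (tensor_comparison C T A) = OnObj T A"
  using assms by (simp_all add: tensor_comparison_def)

lemma comparison_nat:
  assumes "f \<in> Arr C"
  shows "tensor_comparison C T (Cod C f) \<cdot> (f \<boxtimes> Id C (OnObj T (UnitObj C))) =
    OnArr T f \<cdot> tensor_comparison C T (Dom C f)"
proof -
  have *: "OnArr T (RUnitor C (Cod C f)) \<cdot> OnArr T (f \<boxtimes> Id C (UnitObj C)) =
      OnArr T f \<cdot> OnArr T (RUnitor C (Dom C f))"
    using assms RUnitor_nat[of f] by (simp flip: functor_Comp)
  show ?thesis
    using assms St_nat[of f "Id C (UnitObj C)"] by (simp add: tensor_comparison_def reassoc[OF *])
qed

lemma comparison_Eta:
  assumes "A \<in> Obj C"
  shows "tensor_comparison C T A \<cdot> (Id C A \<boxtimes> Eta T (UnitObj C)) = Eta T A \<cdot> RUnitor C A"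
  using assms Eta_nat[of "RUnitor C A"] by (simp add: tensor_comparison_def St_Eta)

text \<open>This is compatibility of \<theta> with strengths, since - \<otimes> T(I) has \<alpha> as
  its strength. The associator law of the strength leaves T of \<rho> at X \<otimes> Y after
  \<alpha>, which \<open>RUnitor_tensor\<close> turns into T(id \<otimes> \<rho>).\<close>

lemma comparison_tensor:
  assumes X: "X \<in> Obj C" and Y: "Y \<in> Obj C"
  shows "tensor_comparison C T (X \<otimes> Y) \<cdot> Assoc C X Y (OnObj T (UnitObj C)) =
    St T (X, Y) \<cdot> (Id C X \<boxtimes> tensor_comparison C T Y)"
proof -
  let ?I = "UnitObj C"
  have "tensor_comparison C T (X \<otimes> Y) \<cdot> Assoc C X Y (OnObj T ?I) =
      OnArr T (RUnitor C (X \<otimes> Y)) \<cdot> (OnArr T (Assoc C X Y ?I) \<cdot>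
        (St T (X, Y \<otimes> ?I) \<cdot> (Id C X \<boxtimes> St T (Y, ?I))))"
    using X Y by (simp add: tensor_comparison_def St_Assoc)
  also have "\<dots> = OnArr T (Id C X \<boxtimes> RUnitor C Y) \<cdot> (St T (X, Y \<otimes> ?I) \<cdot> (Id C X \<boxtimes> St T (Y, ?I)))"
    using X Y by (simp add: reassoc[OF functor_Comp[symmetric]] RUnitor_tensor)
  also have "\<dots> = St T (X, Y) \<cdot> ((Id C X \<boxtimes> OnArr T (RUnitor C Y)) \<cdot> (Id C X \<boxtimes> St T (Y, ?I)))"
    using X Y reassoc[OF St_nat[of "Id C X" "RUnitor C Y"]] by simp
  also have "\<dots> = St T (X, Y) \<cdot> (Id C X \<boxtimes> tensor_comparison C T Y)"
    using X Y by (simp add: tensor_comparison_def interchange)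
  finally show ?thesis .
qed

text \<open>The strength law speaks of T(\<lambda>) and the comparison of T(\<rho>); at I the two
  unitors coincide.\<close>

lemma comparison_UnitObj:
  "tensor_comparison C T (UnitObj C) = LUnitor C (OnObj T (UnitObj C))"
  by (simp add: tensor_comparison_def St_LUnitor flip: LUnitor_UnitObj)

text \<open>The strength law for \<mu> moves \<mu> to the outside and naturality carries it past
  T(\<rho>). The remaining strength followed by \<open>comparison_tensor\<close> gives a comparison
  at A \<otimes> T(I), and naturality of \<theta> at its own component at A finishes.\<close>

lemma comparison_Mu:
  assumes A: "A \<in> Obj C"
  defines "TI \<equiv> OnObj T (UnitObj C)"
  shows "tensor_comparison C T A \<cdot> (Id C A \<boxtimes> (Mu T (UnitObj C) \<cdot> tensor_comparison C T TI)) =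
    Mu T A \<cdot> (tensor_comparison C T (OnObj T A) \<cdot>
      ((tensor_comparison C T A \<boxtimes> Id C TI) \<cdot> Assoc C A TI TI))"
proof -
  let ?I = "UnitObj C" and ?\<theta> = "tensor_comparison C T"
  have TI: "TI \<in> Obj C" "OnObj T ?I = TI" by (simp_all add: TI_def)
  have "?\<theta> A \<cdot> (Id C A \<boxtimes> (Mu T ?I \<cdot> ?\<theta> TI)) =
      OnArr T (RUnitor C A) \<cdot> (St T (A, ?I) \<cdot> ((Id C A \<boxtimes> Mu T ?I) \<cdot> (Id C A \<boxtimes> ?\<theta> TI)))"
    using A TI by (simp add: tensor_comparison_def[of C T A] interchange)
  also have "\<dots> = OnArr T (RUnitor C A) \<cdot> (Mu T (A \<otimes> ?I) \<cdot>
      (OnArr T (St T (A, ?I)) \<cdot> (St T (A, TI) \<cdot> (Id C A \<boxtimes> ?\<theta> TI))))"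
    using A TI by (simp add: reassoc[OF St_Mu])
  also have "\<dots> = Mu T A \<cdot> (OnArr T (?\<theta> A) \<cdot> (?\<theta> (A \<otimes> TI) \<cdot> Assoc C A TI TI))"
    using A TI reassoc[OF Mu_nat[of "RUnitor C A"]] comparison_tensor[of A TI]
    by (simp add: tensor_comparison_def[of C T A])
  also have "\<dots> = Mu T A \<cdot> (?\<theta> (OnObj T A) \<cdot> ((?\<theta> A \<boxtimes> Id C TI) \<cdot> Assoc C A TI TI))"
    using A TI reassoc[OF comparison_nat[of "?\<theta> A"]] by simp
  finally show ?thesis .
qed

end

text \<open>For associativity, \<open>comparison_Mu\<close> at T(I) rewrites m \<cdot> (id \<otimes>
  m), associativity of the monad exchanges \<mu> at T(I) for T of \<mu> at I, and naturality of
  \<theta> leads back to the other bracketing.\<close>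

lemma monoid_of_monad_monoid:
  assumes "strong_monad C T"
  shows "monoid_object C (monoid_of_monad C T)"
proof -
  interpret strong_monad C T by (rule assms)
  let ?I = "UnitObj C" and ?TI = "OnObj T (UnitObj C)" and ?\<theta> = "tensor_comparison C T"
  let ?m = "Mu T ?I \<cdot>\<^bsub>C\<^esub> ?\<theta> ?TI"
  have "?m \<cdot>\<^bsub>C\<^esub> (Id C ?TI \<boxtimes>\<^bsub>C\<^esub> ?m) = Mu T ?I \<cdot>\<^bsub>C\<^esub> (Mu T ?TI \<cdot>\<^bsub>C\<^esub> (?\<theta> (OnObj T ?TI) \<cdot>\<^bsub>C\<^esub>
      ((?\<theta> ?TI \<boxtimes>\<^bsub>C\<^esub> Id C ?TI) \<cdot>\<^bsub>C\<^esub> Assoc C ?TI ?TI ?TI)))"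
    using comparison_Mu[of ?TI] by simp
  also have "\<dots> = Mu T ?I \<cdot>\<^bsub>C\<^esub> (OnArr T (Mu T ?I) \<cdot>\<^bsub>C\<^esub> (?\<theta> (OnObj T ?TI) \<cdot>\<^bsub>C\<^esub>
      ((?\<theta> ?TI \<boxtimes>\<^bsub>C\<^esub> Id C ?TI) \<cdot>\<^bsub>C\<^esub> Assoc C ?TI ?TI ?TI)))"
    by (simp add: reassoc[OF Mu_assoc])
  also have "\<dots> = Mu T ?I \<cdot>\<^bsub>C\<^esub> (?\<theta> ?TI \<cdot>\<^bsub>C\<^esub> ((Mu T ?I \<boxtimes>\<^bsub>C\<^esub> Id C ?TI) \<cdot>\<^bsub>C\<^esub>
      ((?\<theta> ?TI \<boxtimes>\<^bsub>C\<^esub> Id C ?TI) \<cdot>\<^bsub>C\<^esub> Assoc C ?TI ?TI ?TI)))"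
    using reassoc[OF comparison_nat[of "Mu T ?I"]] by simp
  also have "\<dots> = ?m \<cdot>\<^bsub>C\<^esub> ((?m \<boxtimes>\<^bsub>C\<^esub> Id C ?TI) \<cdot>\<^bsub>C\<^esub> Assoc C ?TI ?TI ?TI)"
    by (simp add: interchange_assoc)
  finally have m_assoc: "?m \<cdot>\<^bsub>C\<^esub> ((?m \<boxtimes>\<^bsub>C\<^esub> Id C ?TI) \<cdot>\<^bsub>C\<^esub> Assoc C ?TI ?TI ?TI) =
      ?m \<cdot>\<^bsub>C\<^esub> (Id C ?TI \<boxtimes>\<^bsub>C\<^esub> ?m)" ..
  \<comment> \<open>Naturality of \<theta> turns \<eta> \<otimes> id into T(\<eta>), which \<mu>
    absorbs; the comparison left over is the one at I, hence \<lambda>.\<close>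
  have unit_left: "?m \<cdot>\<^bsub>C\<^esub> (Eta T ?I \<boxtimes>\<^bsub>C\<^esub> Id C ?TI) = LUnitor C ?TI"
    using comparison_nat[of "Eta T ?I"] by (simp add: reassoc[OF Mu_Eta_right] comparison_UnitObj)
  have unit_right: "?m \<cdot>\<^bsub>C\<^esub> (Id C ?TI \<boxtimes>\<^bsub>C\<^esub> Eta T ?I) = RUnitor C ?TI"
    by (simp add: comparison_Eta reassoc[OF Mu_Eta_left])
  show ?thesis
    by unfold_locales (use m_assoc unit_left unit_right in \<open>simp_all add: Hom_iff\<close>)
qed

section \<open>Unitarity of the comparison and the Frobenius law of T(I)\<close>

context strong_frobenius_monad
begin

text \<open>Both factors are unitary: the strength by assumption, T(\<rho>) because \<rho> is
  unitary and T preserves daggers.\<close>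

lemma comparison_unitary:
  assumes A: "A \<in> Obj C"
  shows "unitary C (Dag C) (tensor_comparison C T A)"
  using A functor_iso[of "RUnitor C A"] unitary_simps[OF St_unitary[of A "UnitObj C"]]
  by (intro unitaryI)
    (simp_all add: tensor_comparison_def is_iso_Comp inv_arr_Comp inv_arr_dag functor_dag)

lemma comparison_iso [simp]: "A \<in> Obj C \<Longrightarrow> is_iso C (tensor_comparison C T A)"
  by (rule unitary_simps(2)[OF comparison_unitary])

lemma comparison_dag:
  assumes "A \<in> Obj C"
  shows "Dag C (tensor_comparison C T A) = inv_arr C (tensor_comparison C T A)"
  by (rule unitary_simps(1)[OF comparison_unitary[OF assms], symmetric])

text \<open>Conjugation by the unitary comparison turns both sides into those of the Frobenius law of the
  monad at the unit object.\<close>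

lemma monoid_of_monad_frobenius: "frobenius_monoid C (monoid_of_monad C T)"
proof -
  interpret M: monoid_object C "monoid_of_monad C T"
    by (rule monoid_of_monad_monoid) unfold_locales
  let ?I = "UnitObj C" and ?TI = "OnObj T (UnitObj C)" and ?\<theta> = "tensor_comparison C T"
  let ?m = "Mu T ?I \<cdot> ?\<theta> ?TI" and ?a = "Assoc C ?TI ?TI ?TI"
  let ?L = "(Id C ?TI \<boxtimes> ?m) \<cdot> (inv_arr C ?a \<cdot> (Dag C ?m \<boxtimes> Id C ?TI))"
  let ?R = "(?m \<boxtimes> Id C ?TI) \<cdot> (?a \<cdot> (Id C ?TI \<boxtimes> Dag C ?m))"
  have dag_m: "Dag C ?m = inv_arr C (?\<theta> ?TI) \<cdot> Dag C (Mu T ?I)"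
    by (simp add: comparison_dag)
  have "?\<theta> ?TI \<cdot> ?L = Mu T ?TI \<cdot> (?\<theta> (OnObj T ?TI) \<cdot> ((?\<theta> ?TI \<boxtimes> Id C ?TI) \<cdot>
      (Dag C ?m \<boxtimes> Id C ?TI)))"
    using reassoc[OF comparison_Mu[of ?TI]] by simp
  \<comment> \<open>The dagger of m begins with the inverse of \<theta> at T(I), which cancels
    against \<theta> and leaves only the dagger of \<mu>.\<close>
  also have "\<dots> = Mu T ?TI \<cdot> (?\<theta> (OnObj T ?TI) \<cdot> (Dag C (Mu T ?I) \<boxtimes> Id C ?TI))"
    unfolding dag_m by (simp add: interchange)
  also have "\<dots> = Mu T ?TI \<cdot> (OnArr T (Dag C (Mu T ?I)) \<cdot> ?\<theta> ?TI)"
    using comparison_nat[of "Dag C (Mu T ?I)"] by simp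
  also have "\<dots> = OnArr T (Mu T ?I) \<cdot> (Dag C (Mu T ?TI) \<cdot> ?\<theta> ?TI)"
    by (simp add: reassoc[OF monad_frobenius_law[symmetric]])
  finally have L: "?\<theta> ?TI \<cdot> ?L = OnArr T (Mu T ?I) \<cdot> (Dag C (Mu T ?TI) \<cdot> ?\<theta> ?TI)" .
  \<comment> \<open>The dagger of \<open>comparison_Mu\<close> at T(I), with every dagger of a
    comparison or associator replaced by the inverse.\<close>
  have "(Id C ?TI \<boxtimes> Dag C ?m) \<cdot> inv_arr C (?\<theta> ?TI) =
      inv_arr C ?a \<cdot> ((inv_arr C (?\<theta> ?TI) \<boxtimes> Id C ?TI) \<cdot>
        (inv_arr C (?\<theta> (OnObj T ?TI)) \<cdot> Dag C (Mu T ?TI)))"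
    using arg_cong[OF comparison_Mu[of ?TI], of "Dag C"]
    by (simp add: comparison_dag inv_arr_dag)
  then have "?a \<cdot> (((Id C ?TI \<boxtimes> Dag C ?m) \<cdot> inv_arr C (?\<theta> ?TI)) \<cdot> ?\<theta> ?TI) =
      (inv_arr C (?\<theta> ?TI) \<boxtimes> Id C ?TI) \<cdot>
        (inv_arr C (?\<theta> (OnObj T ?TI)) \<cdot> (Dag C (Mu T ?TI) \<cdot> ?\<theta> ?TI))"
    by simp
  then have R': "?a \<cdot> (Id C ?TI \<boxtimes> Dag C ?m) = (inv_arr C (?\<theta> ?TI) \<boxtimes> Id C ?TI) \<cdot>
        (inv_arr C (?\<theta> (OnObj T ?TI)) \<cdot> (Dag C (Mu T ?TI) \<cdot> ?\<theta> ?TI))"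
    by (simp del: dag_Comp')
  \<comment> \<open>The \<theta> contained in m \<otimes> id cancels the first inverse; naturality
    of \<theta> at \<mu> then exposes the second for cancellation.\<close>
  have "?\<theta> ?TI \<cdot> ?R = ?\<theta> ?TI \<cdot> ((Mu T ?I \<boxtimes> Id C ?TI) \<cdot>
        (inv_arr C (?\<theta> (OnObj T ?TI)) \<cdot> (Dag C (Mu T ?TI) \<cdot> ?\<theta> ?TI)))"
    unfolding R' by (simp add: interchange_assoc)
  also have "\<dots> = OnArr T (Mu T ?I) \<cdot> (Dag C (Mu T ?TI) \<cdot> ?\<theta> ?TI)"
    using reassoc[OF comparison_nat[of "Mu T ?I"]] by simp
  finally have "?\<theta> ?TI \<cdot> ?L = ?\<theta> ?TI \<cdot> ?R"
    using L by simp
  then have "?L = ?R"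
    by (rule iso_cancel_left) simp_all
  then show ?thesis
    by unfold_locales (simp del: dag_Comp')
qed

end

section \<open>The two categories\<close>

lemma monoid_hom_simps:
  assumes "monoid_hom C A B f"
  shows "f \<in> Arr C" "Dom C f = MObj A" "Cod C f = MObj B"
    "f \<cdot>\<^bsub>C\<^esub> MMult A = MMult B \<cdot>\<^bsub>C\<^esub> (f \<boxtimes>\<^bsub>C\<^esub> f)" "f \<cdot>\<^bsub>C\<^esub> MUnit A = MUnit B"
  using assms by (auto simp: monoid_hom_def Hom_def)

lemma monoid_hom_Id:
  assumes "monoid_object C B"
  shows "monoid_hom C B B (Id C (MObj B))"
proof -
  interpret monoid_object C B by (rule assms)
  show ?thesis by (simp add: monoid_hom_def Hom_iff)
qed

lemma monoid_hom_Comp: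
  assumes "monoid_object C A" "monoid_object C B" "monoid_object C D"
    and f: "monoid_hom C A B f" and g: "monoid_hom C B D g"
  shows "monoid_hom C A D (g \<cdot>\<^bsub>C\<^esub> f)"
proof -
  interpret A: monoid_object C A by fact
  interpret B: monoid_object C B by fact
  interpret D: monoid_object C D by fact
  note fs = monoid_hom_simps[OF f] and gs = monoid_hom_simps[OF g]
  show ?thesis
    using fs(1-3) gs(1-3)
    by (simp add: monoid_hom_def A.Hom_iff fs(4,5) gs(5) A.reassoc[OF gs(4)] A.interchange)
qed

lemma monoid_hom_inv_arr:
  assumes "monoid_object C A" "monoid_object C B" and f: "monoid_hom C A B f" and iso: "is_iso C f"
  shows "monoid_hom C B A (inv_arr C f)"
proof -
  interpret A: monoid_object C A by fact
  interpret B: monoid_object C B by fact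
  note fs = monoid_hom_simps[OF f]
  have "MMult A \<cdot>\<^bsub>C\<^esub> inv_arr C (f \<boxtimes>\<^bsub>C\<^esub> f) = inv_arr C f \<cdot>\<^bsub>C\<^esub> MMult B"
    using fs iso by (intro A.natural_inv_arr) (simp_all add: A.is_iso_Tensor)
  moreover have "inv_arr C f \<cdot>\<^bsub>C\<^esub> MUnit B = MUnit A"
    using fs(1-3) iso by (simp flip: fs(5))
  ultimately show ?thesis
    using fs(1-3) iso by (simp add: monoid_hom_def A.Hom_iff A.inv_arr_Tensor)
qed

lemma strong_monad_hom_simps:
  assumes "strong_monad_hom C T S \<beta>" "A \<in> Obj C"
  shows "\<beta> A \<in> Arr C" "Dom C (\<beta> A) = OnObj T A" "Cod C (\<beta> A) = OnObj S A"
    "\<beta> A \<cdot>\<^bsub>C\<^esub> Eta T A = Eta S A"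
    "\<beta> A \<cdot>\<^bsub>C\<^esub> Mu T A = Mu S A \<cdot>\<^bsub>C\<^esub> (\<beta> (OnObj S A) \<cdot>\<^bsub>C\<^esub> OnArr T (\<beta> A))"
    "B \<in> Obj C \<Longrightarrow>
      \<beta> (A \<otimes>\<^bsub>C\<^esub> B) \<cdot>\<^bsub>C\<^esub> St T (A, B) = St S (A, B) \<cdot>\<^bsub>C\<^esub> (Id C A \<boxtimes>\<^bsub>C\<^esub> \<beta> B)"
  using assms by (auto simp: strong_monad_hom_def natural_transformation_simps)

lemma strong_monad_hom_nat:
  assumes "strong_monad_hom C T S \<beta>" "f \<in> Arr C"
  shows "\<beta> (Cod C f) \<cdot>\<^bsub>C\<^esub> OnArr T f = OnArr S f \<cdot>\<^bsub>C\<^esub> \<beta> (Dom C f)"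
  using assms by (auto simp: strong_monad_hom_def intro: natural_transformation_nat)

lemma strong_monad_hom_extensional:
  assumes "strong_monad_hom C T S \<beta>"
  shows "\<beta> \<in> extensional (Obj C)"
  using assms by (auto simp: strong_monad_hom_def natural_transformation_def)

lemma strong_monad_hom_Id:
  assumes "strong_monad C T"
  shows "strong_monad_hom C T T (\<lambda>A \<in> Obj C. Id C (OnObj T A))"
proof -
  interpret strong_monad C T by (rule assms)
  show ?thesis
    unfolding strong_monad_hom_def by (auto simp: monad_functor intro!: natural_transformationI)
qed

lemma strong_monad_hom_Comp:
  assumes "strong_monad C T" "strong_monad C S" "strong_monad C R"
    and \<beta>: "strong_monad_hom C T S \<beta>" and \<gamma>: "strong_monad_hom C S R \<gamma>"
  shows "strong_monad_hom C T R (\<lambda>A \<in> Obj C. \<gamma> A \<cdot>\<^bsub>C\<^esub> \<beta> A)"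
proof -
  interpret T: strong_monad C T by fact
  interpret S: strong_monad C S by fact
  interpret R: strong_monad C R by fact
  note bs = strong_monad_hom_simps[OF \<beta>] and gs = strong_monad_hom_simps[OF \<gamma>]
  note [simp] = bs(1-3) gs(1-3)
  have "natural_transformation C C T R (\<lambda>A \<in> Obj C. \<gamma> A \<cdot>\<^bsub>C\<^esub> \<beta> A)"
    by (rule natural_transformationI)
      (simp_all add: T.monad_functor R.monad_functor strong_monad_hom_nat[OF \<beta>]
        T.reassoc[OF strong_monad_hom_nat[OF \<gamma>]])
  moreover have "(\<gamma> A \<cdot>\<^bsub>C\<^esub> \<beta> A) \<cdot>\<^bsub>C\<^esub> Mu T A =
      Mu R A \<cdot>\<^bsub>C\<^esub> ((\<gamma> (OnObj R A) \<cdot>\<^bsub>C\<^esub> \<beta> (OnObj R A)) \<cdot>\<^bsub>C\<^esub> OnArr T (\<gamma> A \<cdot>\<^bsub>C\<^esub> \<beta> A))"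
    if A: "A \<in> Obj C" for A
  proof -
    have "(\<gamma> A \<cdot>\<^bsub>C\<^esub> \<beta> A) \<cdot>\<^bsub>C\<^esub> Mu T A =
        Mu R A \<cdot>\<^bsub>C\<^esub> (\<gamma> (OnObj R A) \<cdot>\<^bsub>C\<^esub> (OnArr S (\<gamma> A) \<cdot>\<^bsub>C\<^esub>
          (\<beta> (OnObj S A) \<cdot>\<^bsub>C\<^esub> OnArr T (\<beta> A))))"
      using A by (simp add: bs(5) T.reassoc[OF gs(5)])
    \<comment> \<open>Naturality of \<beta> at the component of \<gamma> interchanges S(\<gamma>)
      and \<beta>, which sorts the two transformations into their composite.\<close>
    also have "\<dots> = Mu R A \<cdot>\<^bsub>C\<^esub> ((\<gamma> (OnObj R A) \<cdot>\<^bsub>C\<^esub> \<beta> (OnObj R A)) \<cdot>\<^bsub>C\<^esub> OnArr T (\<gamma> A \<cdot>\<^bsub>C\<^esub> \<beta> A))"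
      using A T.reassoc[OF strong_monad_hom_nat[OF \<beta>, of "\<gamma> A"]] by simp
    finally show ?thesis .
  qed
  ultimately show ?thesis
    unfolding strong_monad_hom_def
    \<comment> \<open>Reassociation and expansion of T on composites are withheld in the first pass,
      so that the multiplication law is met in the form just proved.\<close>
    by (simp add: bs(4,6) gs(4) T.reassoc[OF gs(6)] T.interchange del: T.assoc T.functor_Comp)
      (simp add: bs(4,6) gs(4) T.reassoc[OF gs(6)] T.interchange)
qed

lemma strong_monad_hom_inv_arr:
  assumes "strong_monad C T" "strong_monad C S" and \<beta>: "strong_monad_hom C T S \<beta>"
    and iso: "\<And>A. A \<in> Obj C \<Longrightarrow> is_iso C (\<beta> A)"
  shows "strong_monad_hom C S T (\<lambda>A \<in> Obj C. inv_arr C (\<beta> A))"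
proof -
  interpret T: strong_monad C T by fact
  interpret S: strong_monad C S by fact
  note bs = strong_monad_hom_simps[OF \<beta>]
  note [simp] = bs(1-3) iso
  have nat: "OnArr T f \<cdot>\<^bsub>C\<^esub> inv_arr C (\<beta> (Dom C f)) = inv_arr C (\<beta> (Cod C f)) \<cdot>\<^bsub>C\<^esub> OnArr S f"
    if "f \<in> Arr C" for f
    using that by (intro T.natural_inv_arr strong_monad_hom_nat[OF \<beta>]) simp_all
  have "natural_transformation C C S T (\<lambda>A \<in> Obj C. inv_arr C (\<beta> A))"
    by (rule natural_transformationI) (simp_all add: T.monad_functor S.monad_functor nat)
  moreover have "inv_arr C (\<beta> A) \<cdot>\<^bsub>C\<^esub> Eta S A = Eta T A" if "A \<in> Obj C" for A
    using that by (simp flip: bs(4))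
  moreover have "inv_arr C (\<beta> A) \<cdot>\<^bsub>C\<^esub> Mu S A =
      Mu T A \<cdot>\<^bsub>C\<^esub> (inv_arr C (\<beta> (OnObj T A)) \<cdot>\<^bsub>C\<^esub> OnArr S (inv_arr C (\<beta> A)))"
    if A: "A \<in> Obj C" for A
  proof -
    have "Mu T A \<cdot>\<^bsub>C\<^esub> inv_arr C (\<beta> (OnObj S A) \<cdot>\<^bsub>C\<^esub> OnArr T (\<beta> A)) = inv_arr C (\<beta> A) \<cdot>\<^bsub>C\<^esub> Mu S A"
      using A by (intro T.natural_inv_arr bs(5)) (simp_all add: T.is_iso_Comp T.functor_is_iso)
    \<comment> \<open>Inversion reverses the two factors on the right; naturality of the inverse
      family restores the required order.\<close>
    then show ?thesis
      using A nat[of "inv_arr C (\<beta> A)"]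
      by (simp add: T.inv_arr_Comp T.functor_is_iso T.functor_inv_arr)
  qed
  moreover have "inv_arr C (\<beta> (A \<otimes>\<^bsub>C\<^esub> B)) \<cdot>\<^bsub>C\<^esub> St S (A, B) =
      St T (A, B) \<cdot>\<^bsub>C\<^esub> (Id C A \<boxtimes>\<^bsub>C\<^esub> inv_arr C (\<beta> B))"
    if A: "A \<in> Obj C" and B: "B \<in> Obj C" for A B
  proof -
    have "St T (A, B) \<cdot>\<^bsub>C\<^esub> inv_arr C (Id C A \<boxtimes>\<^bsub>C\<^esub> \<beta> B) = inv_arr C (\<beta> (A \<otimes>\<^bsub>C\<^esub> B)) \<cdot>\<^bsub>C\<^esub> St S (A, B)"
      using A B by (intro T.natural_inv_arr bs(6)) (simp_all add: T.is_iso_Tensor)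
    then show ?thesis
      using A B by (simp add: T.inv_arr_Tensor)
  qed
  ultimately show ?thesis
    unfolding strong_monad_hom_def by simp
qed

section \<open>Composition and isomorphisms in the two categories\<close>

lemma FrobMonoids_simps [simp]:
  "B \<in> Obj (FrobMonoids C) \<longleftrightarrow> frobenius_monoid C B"
  "f \<in> Arr (FrobMonoids C) \<longleftrightarrow> frobenius_monoid C (src f) \<and> frobenius_monoid C (tgt f) \<and>
     monoid_hom C (src f) (tgt f) (und f)"
  "Dom (FrobMonoids C) = src" "Cod (FrobMonoids C) = tgt"
  "Id (FrobMonoids C) B = StrArr B B (Id C (MObj B))"
  "g \<cdot>\<^bsub>FrobMonoids C\<^esub> f = StrArr (src f) (tgt g) (und g \<cdot>\<^bsub>C\<^esub> und f)"
  by (cases f; auto simp: FrobMonoids_def)+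

lemma StrongFrobMonads_simps [simp]:
  "T \<in> Obj (StrongFrobMonads C) \<longleftrightarrow> strong_frobenius_monad C T"
  "\<beta> \<in> Arr (StrongFrobMonads C) \<longleftrightarrow>
     strong_frobenius_monad C (src \<beta>) \<and> strong_frobenius_monad C (tgt \<beta>) \<and>
     strong_monad_hom C (src \<beta>) (tgt \<beta>) (und \<beta>)"
  "Dom (StrongFrobMonads C) = src" "Cod (StrongFrobMonads C) = tgt"
  "Id (StrongFrobMonads C) T = StrArr T T (\<lambda>A \<in> Obj C. Id C (OnObj T A))"
  "\<gamma> \<cdot>\<^bsub>StrongFrobMonads C\<^esub> \<beta> = StrArr (src \<beta>) (tgt \<gamma>) (\<lambda>A \<in> Obj C. und \<gamma> A \<cdot>\<^bsub>C\<^esub> und \<beta> A)"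
  by (cases \<beta>; auto simp: StrongFrobMonads_def)+

lemma frobenius_monoid_is_monoid: "frobenius_monoid C B \<Longrightarrow> monoid_object C B"
  by (simp add: frobenius_monoid_def)

lemma strong_frobenius_monad_is_strong: "strong_frobenius_monad C T \<Longrightarrow> strong_monad C T"
  by (simp add: strong_frobenius_monad_def)

context monoidal_dagger_category
begin

lemma FrobMonoids_category: "category (FrobMonoids C)"
proof
  fix f A B assume f: "f \<in> Hom (FrobMonoids C) A B"
  then have "und f \<in> Arr C" "Dom C (und f) = MObj A" "Cod C (und f) = MObj B"
    by (auto simp: Hom_def monoid_hom_simps)
  then show "Id (FrobMonoids C) B \<cdot>\<^bsub>FrobMonoids C\<^esub> f = f"
    and "f \<cdot>\<^bsub>FrobMonoids C\<^esub> Id (FrobMonoids C) A = f"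
    using f by (cases f; simp add: Hom_def)+
next
  fix f g h W X Y Z
  assume "f \<in> Hom (FrobMonoids C) W X" "g \<in> Hom (FrobMonoids C) X Y" "h \<in> Hom (FrobMonoids C) Y Z"
  then show "(h \<cdot>\<^bsub>FrobMonoids C\<^esub> g) \<cdot>\<^bsub>FrobMonoids C\<^esub> f = h \<cdot>\<^bsub>FrobMonoids C\<^esub> g \<cdot>\<^bsub>FrobMonoids C\<^esub> f"
    by (auto simp: Hom_def monoid_hom_simps)
next
  fix f g X Y Z
  assume "f \<in> Hom (FrobMonoids C) X Y" "g \<in> Hom (FrobMonoids C) Y Z"
  then show "g \<cdot>\<^bsub>FrobMonoids C\<^esub> f \<in> Hom (FrobMonoids C) X Z"
    using monoid_hom_Comp[of C X Y Z "und f" "und g"]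
    by (auto simp: Hom_def frobenius_monoid_is_monoid)
qed (auto simp: Hom_def frobenius_monoid_is_monoid intro: monoid_hom_Id)

lemma FrobMonoids_is_iso:
  assumes "f \<in> Arr (FrobMonoids C)" "is_iso C (und f)"
  shows "is_iso (FrobMonoids C) f"
proof -
  interpret F: category "FrobMonoids C" by (rule FrobMonoids_category)
  have "inverse_arrows (FrobMonoids C) f (StrArr (tgt f) (src f) (inv_arr C (und f)))"
    using assms by (auto simp: inverse_arrows_def F.Hom_iff monoid_hom_inv_arr
        frobenius_monoid_is_monoid monoid_hom_simps)
  then show ?thesis by (rule F.is_isoI)
qed

lemma StrongFrobMonads_category: "category (StrongFrobMonads C)"
proof
  fix f T S assume f: "f \<in> Hom (StrongFrobMonads C) T S"
  then have "strong_monad_hom C T S (und f)"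
    by (auto simp: Hom_def)
  \<comment> \<open>Composition in this category restricts to the objects of C, so the identity laws
    give back the family itself only because it is extensional.\<close>
  then have "(\<lambda>A \<in> Obj C. Id C (OnObj S A) \<cdot> und f A) = und f"
    and "(\<lambda>A \<in> Obj C. und f A \<cdot> Id C (OnObj T A)) = und f"
    by (auto intro!: extensionalityI[of _ "Obj C"]
        simp: strong_monad_hom_extensional strong_monad_hom_simps)
  then show "Id (StrongFrobMonads C) S \<cdot>\<^bsub>StrongFrobMonads C\<^esub> f = f"
    and "f \<cdot>\<^bsub>StrongFrobMonads C\<^esub> Id (StrongFrobMonads C) T = f"
    using f by (cases f; simp add: Hom_def cong: restrict_cong)+
next
  fix f g h W X Y Z
  assume "f \<in> Hom (StrongFrobMonads C) W X" "g \<in> Hom (StrongFrobMonads C) X Y"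
    "h \<in> Hom (StrongFrobMonads C) Y Z"
  then show "(h \<cdot>\<^bsub>StrongFrobMonads C\<^esub> g) \<cdot>\<^bsub>StrongFrobMonads C\<^esub> f =
      h \<cdot>\<^bsub>StrongFrobMonads C\<^esub> g \<cdot>\<^bsub>StrongFrobMonads C\<^esub> f"
    by (auto simp: Hom_def strong_monad_hom_simps intro!: restrict_ext)
next
  fix f g X Y Z
  assume "f \<in> Hom (StrongFrobMonads C) X Y" "g \<in> Hom (StrongFrobMonads C) Y Z"
  then show "g \<cdot>\<^bsub>StrongFrobMonads C\<^esub> f \<in> Hom (StrongFrobMonads C) X Z"
    using strong_monad_hom_Comp[of C X Y Z "und f" "und g"]
    by (auto simp: Hom_def strong_frobenius_monad_is_strong)
qed (auto simp: Hom_def strong_frobenius_monad_is_strong intro: strong_monad_hom_Id)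

text \<open>Componentwise inverses again form a morphism of strong monads. This reduces
  invertibility of the counit to invertibility of each comparison.\<close>

lemma StrongFrobMonads_is_iso:
  assumes "\<beta> \<in> Arr (StrongFrobMonads C)" "\<And>A. A \<in> Obj C \<Longrightarrow> is_iso C (und \<beta> A)"
  shows "is_iso (StrongFrobMonads C) \<beta>"
proof -
  interpret F: category "StrongFrobMonads C" by (rule StrongFrobMonads_category)
  have "inverse_arrows (StrongFrobMonads C) \<beta>
      (StrArr (tgt \<beta>) (src \<beta>) (\<lambda>A \<in> Obj C. inv_arr C (und \<beta> A)))"
    using assms by (auto simp: inverse_arrows_def F.Hom_iff strong_monad_hom_inv_arr
        strong_frobenius_monad_is_strong strong_monad_hom_simps intro!: restrict_ext)
  then show ?thesis by (rule F.is_isoI)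
qed

end

section \<open>The equivalence\<close>

lemma tensor_monad_hom:
  assumes "monoid_object C A" "monoid_object C B" and f: "monoid_hom C A B f"
  shows "strong_monad_hom C (tensor_monad C A) (tensor_monad C B) (\<lambda>X \<in> Obj C. Id C X \<boxtimes>\<^bsub>C\<^esub> f)"
proof -
  interpret A: monoid_object C A by fact
  interpret B: monoid_object C B by fact
  note fs = monoid_hom_simps[OF f]
  note [simp] = fs(1-3)
  have "natural_transformation C C (tensor_monad C A) (tensor_monad C B)
      (\<lambda>X \<in> Obj C. Id C X \<boxtimes>\<^bsub>C\<^esub> f)"
    by (rule natural_transformationI)
      (simp_all add: A.tensor_monad_functor B.tensor_monad_functor A.interchange)
  moreover have "(Id C X \<boxtimes>\<^bsub>C\<^esub> f) \<cdot>\<^bsub>C\<^esub> Eta (tensor_monad C A) X = Eta (tensor_monad C B) X"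
    if "X \<in> Obj C" for X
    using that by (simp add: A.interchange_assoc fs(5))
  moreover have "(Id C X \<boxtimes>\<^bsub>C\<^esub> f) \<cdot>\<^bsub>C\<^esub> Mu (tensor_monad C A) X = Mu (tensor_monad C B) X \<cdot>\<^bsub>C\<^esub>
      ((Id C (X \<otimes>\<^bsub>C\<^esub> MObj B) \<boxtimes>\<^bsub>C\<^esub> f) \<cdot>\<^bsub>C\<^esub> ((Id C X \<boxtimes>\<^bsub>C\<^esub> f) \<boxtimes>\<^bsub>C\<^esub> Id C (MObj A)))"
    if "X \<in> Obj C" for X
    \<comment> \<open>Naturality with f in both of the last two factors matches the two copies of f
      in the homomorphism law.\<close>
    using that A.Assoc_inv_nat[of "Id C X" f f]
    by (simp add: A.interchange_assoc A.interchange fs(4))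
  moreover have "(Id C (X \<otimes>\<^bsub>C\<^esub> Y) \<boxtimes>\<^bsub>C\<^esub> f) \<cdot>\<^bsub>C\<^esub> Assoc C X Y (MObj A) =
      Assoc C X Y (MObj B) \<cdot>\<^bsub>C\<^esub> (Id C X \<boxtimes>\<^bsub>C\<^esub> (Id C Y \<boxtimes>\<^bsub>C\<^esub> f))"
    if "X \<in> Obj C" "Y \<in> Obj C" for X Y
    using that A.Assoc_nat[of "Id C X" "Id C Y" f] by simp
  ultimately show ?thesis
    unfolding strong_monad_hom_def by simp
qed

text \<open>Naturality of \<beta> at \<rho> followed by its compatibility with the strength at I. It
  is the naturality of the counit in T.\<close>

lemma strong_monad_hom_comparison:
  assumes "strong_monad C T" "strong_monad C S" and \<beta>: "strong_monad_hom C T S \<beta>"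
    and A: "A \<in> Obj C"
  shows "\<beta> A \<cdot>\<^bsub>C\<^esub> tensor_comparison C T A =
    tensor_comparison C S A \<cdot>\<^bsub>C\<^esub> (Id C A \<boxtimes>\<^bsub>C\<^esub> \<beta> (UnitObj C))"
proof -
  interpret T: strong_monad C T by fact
  interpret S: strong_monad C S by fact
  note bs = strong_monad_hom_simps[OF \<beta>]
  show ?thesis
    using A T.reassoc[OF strong_monad_hom_nat[OF \<beta>, of "RUnitor C A"]]
    by (simp add: tensor_comparison_def bs)
qed

text \<open>In the multiplication law of \<beta>, naturality of \<theta> puts one copy of \<beta> at
  I on the left factor, and \<open>strong_monad_hom_comparison\<close> puts the other on the right
  factor.\<close>

lemma monoid_of_monad_hom:
  assumes T: "strong_monad C T" and S: "strong_monad C S" and \<beta>: "strong_monad_hom C T S \<beta>"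
  shows "monoid_hom C (monoid_of_monad C T) (monoid_of_monad C S) (\<beta> (UnitObj C))"
proof -
  interpret T: strong_monad C T by fact
  interpret S: strong_monad C S by fact
  let ?I = "UnitObj C"
  note bs = strong_monad_hom_simps[OF \<beta>]
  note [simp] = bs(1-3)
  have "\<beta> ?I \<cdot>\<^bsub>C\<^esub> (Mu T ?I \<cdot>\<^bsub>C\<^esub> tensor_comparison C T (OnObj T ?I)) =
      Mu S ?I \<cdot>\<^bsub>C\<^esub> (\<beta> (OnObj S ?I) \<cdot>\<^bsub>C\<^esub>
        (OnArr T (\<beta> ?I) \<cdot>\<^bsub>C\<^esub> tensor_comparison C T (OnObj T ?I)))"
    by (simp add: T.reassoc[OF bs(5)])
  also have "\<dots> = Mu S ?I \<cdot>\<^bsub>C\<^esub> (\<beta> (OnObj S ?I) \<cdot>\<^bsub>C\<^esub>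
      (tensor_comparison C T (OnObj S ?I) \<cdot>\<^bsub>C\<^esub> (\<beta> ?I \<boxtimes>\<^bsub>C\<^esub> Id C (OnObj T ?I))))"
    using T.comparison_nat[of "\<beta> ?I"] by simp
  also have "\<dots> = Mu S ?I \<cdot>\<^bsub>C\<^esub> (tensor_comparison C S (OnObj S ?I) \<cdot>\<^bsub>C\<^esub> (\<beta> ?I \<boxtimes>\<^bsub>C\<^esub> \<beta> ?I))"
    by (simp add: T.reassoc[OF strong_monad_hom_comparison[OF T S \<beta>]] T.interchange)
  finally show ?thesis
    by (simp add: monoid_hom_def T.Hom_iff bs(4))
qed

context monoid_object
begin

lemma tensor_monad_comparison:
  assumes "A \<in> Obj C"
  shows "tensor_comparison C (tensor_monad C B) A = Id C A \<boxtimes> LUnitor C (MObj B)"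
  using assms by (simp add: tensor_comparison_def triangle)

text \<open>For T = - \<otimes> B the comparison is id \<otimes> \<lambda> by the triangle, which
  makes the multiplication on I \<otimes> B explicit; the law then follows from naturality of
  \<lambda> and \<open>LUnitor_tensor\<close>.\<close>

lemma LUnitor_monoid_hom:
  "monoid_hom C (monoid_of_monad C (tensor_monad C B)) B (LUnitor C (MObj B))"
proof -
  let ?I = "UnitObj C" and ?b = "MObj B" and ?m = "MMult B" and ?e = "MUnit B"
  have *: "LUnitor C (?b \<otimes> ?b) \<cdot> inv_arr C (Assoc C ?I ?b ?b) = LUnitor C ?b \<boxtimes> Id C ?b"
    by (simp flip: LUnitor_tensor)
  have "LUnitor C ?b \<cdot> ((Id C ?I \<boxtimes> ?m) \<cdot> (inv_arr C (Assoc C ?I ?b ?b) \<cdot>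
      (Id C (?I \<otimes> ?b) \<boxtimes> LUnitor C ?b))) = ?m \<cdot> (LUnitor C ?b \<boxtimes> LUnitor C ?b)"
    using reassoc[OF LUnitor_nat[of ?m]]
    by (simp add: reassoc[OF *] interchange)
  moreover have "LUnitor C ?b \<cdot> ((Id C ?I \<boxtimes> ?e) \<cdot> inv_arr C (RUnitor C ?I)) = ?e"
    using reassoc[OF LUnitor_nat[of ?e]] by (simp add: LUnitor_UnitObj)
  ultimately show ?thesis
    by (simp add: monoid_hom_def Hom_iff tensor_monad_comparison)
qed

end

text \<open>The laws are \<open>comparison_Eta\<close>, \<open>comparison_Mu\<close> and
  \<open>comparison_tensor\<close>, the first two composed with the inverse coherence map in the
  unit and multiplication of - \<otimes> T(I). Unitarity of the strength enters only later, for
  invertibility.\<close>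

lemma comparison_strong_monad_hom:
  assumes T: "strong_monad C T"
  shows "strong_monad_hom C (tensor_monad C (monoid_of_monad C T)) T
    (\<lambda>A \<in> Obj C. tensor_comparison C T A)"
proof -
  interpret T: strong_monad C T by fact
  interpret M: monoid_object C "monoid_of_monad C T" by (rule monoid_of_monad_monoid[OF T])
  let ?M = "monoid_of_monad C T"
  have "natural_transformation C C (tensor_monad C ?M) T (\<lambda>A \<in> Obj C. tensor_comparison C T A)"
    by (rule natural_transformationI)
      (simp_all add: M.tensor_monad_functor T.monad_functor T.comparison_nat)
  moreover have "tensor_comparison C T A \<cdot>\<^bsub>C\<^esub> Eta (tensor_monad C ?M) A = Eta T A"
    if "A \<in> Obj C" for A
    using that by (simp add: T.reassoc[OF T.comparison_Eta])
  moreover have "tensor_comparison C T A \<cdot>\<^bsub>C\<^esub> Mu (tensor_monad C ?M) A =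
      Mu T A \<cdot>\<^bsub>C\<^esub> (tensor_comparison C T (OnObj T A) \<cdot>\<^bsub>C\<^esub>
        (tensor_comparison C T A \<boxtimes>\<^bsub>C\<^esub> Id C (OnObj T (UnitObj C))))"
    if "A \<in> Obj C" for A
    using that by (simp add: T.reassoc[OF T.comparison_Mu])
  ultimately show ?thesis
    unfolding strong_monad_hom_def by (simp add: T.comparison_tensor)
qed

section \<open>The two functors, the unit and the counit\<close>

context monoidal_dagger_category
begin

lemma tensor_functor_is_functor:
  "is_functor (FrobMonoids C) (StrongFrobMonads C) (tensor_functor C)"
proof (rule is_functorI)
  fix B assume B: "B \<in> Obj (FrobMonoids C)"
  then interpret frobenius_monoid C B by simp
  show "OnObj (tensor_functor C) B \<in> Obj (StrongFrobMonads C) \<and>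
      OnArr (tensor_functor C) (Id (FrobMonoids C) B) =
        Id (StrongFrobMonads C) (OnObj (tensor_functor C) B)"
    using B by (simp add: tensor_functor_def tensor_monad_frobenius monoid_hom_Id
        frobenius_monoid_is_monoid cong: restrict_cong)
next
  fix f g assume f: "f \<in> Arr (FrobMonoids C)" and g: "g \<in> Arr (FrobMonoids C)"
    and fg: "Dom (FrobMonoids C) g = Cod (FrobMonoids C) f"
  \<comment> \<open>The functor's arrow map is restricted to arrows, so it can be evaluated at the
    composite only after the composite is known to be one.\<close>
  have gf: "g \<cdot>\<^bsub>FrobMonoids C\<^esub> f \<in> Arr (FrobMonoids C)"
    using category.Comp_simps(1)[OF FrobMonoids_category f g fg] .
  have "und f \<in> Arr C" "und g \<in> Arr C" "Dom C (und g) = Cod C (und f)"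
    using f g fg by (auto simp: monoid_hom_simps)
  then show "OnArr (tensor_functor C) (g \<cdot>\<^bsub>FrobMonoids C\<^esub> f) =
      OnArr (tensor_functor C) g \<cdot>\<^bsub>StrongFrobMonads C\<^esub> OnArr (tensor_functor C) f"
    using f g gf by (simp add: tensor_functor_def interchange cong: restrict_cong)
qed (auto simp: FrobMonoids_category StrongFrobMonads_category tensor_functor_def
    frobenius_monoid.tensor_monad_frobenius tensor_monad_hom frobenius_monoid_is_monoid)

lemma eval_unit_functor_is_functor:
  "is_functor (StrongFrobMonads C) (FrobMonoids C) (eval_unit_functor C)"
proof (rule is_functorI)
  fix f g assume f: "f \<in> Arr (StrongFrobMonads C)" and g: "g \<in> Arr (StrongFrobMonads C)"
    and fg: "Dom (StrongFrobMonads C) g = Cod (StrongFrobMonads C) f"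
  have "g \<cdot>\<^bsub>StrongFrobMonads C\<^esub> f \<in> Arr (StrongFrobMonads C)"
    using category.Comp_simps(1)[OF StrongFrobMonads_category f g fg] .
  then show "OnArr (eval_unit_functor C) (g \<cdot>\<^bsub>StrongFrobMonads C\<^esub> f) =
      OnArr (eval_unit_functor C) g \<cdot>\<^bsub>FrobMonoids C\<^esub> OnArr (eval_unit_functor C) f"
    using f g by (simp add: eval_unit_functor_def)
qed (auto simp: FrobMonoids_category StrongFrobMonads_category eval_unit_functor_def
    strong_frobenius_monad.monoid_of_monad_frobenius monoid_of_monad_hom
    strong_frobenius_monad_is_strong strong_monad_hom_Id)

text \<open>The homomorphism checked directly is \<lambda> from I \<otimes> B to B. The unit points
  the other way, so its inverse is taken, and naturality is that of the inverse left unitor.\<close>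

lemma equivalence_unit:
  "natural_isomorphism (FrobMonoids C) (FrobMonoids C) (id_functor (FrobMonoids C))
     (comp_functor (FrobMonoids C) (eval_unit_functor C) (tensor_functor C))
     (\<lambda>B \<in> Obj (FrobMonoids C).
        StrArr B (monoid_of_monad C (tensor_monad C B)) (inv_arr C (LUnitor C (MObj B))))"
  (is "natural_isomorphism ?F ?F ?I ?GF ?\<eta>")
proof -
  interpret F: category ?F by (rule FrobMonoids_category)
  have GF: "frobenius_monoid C (monoid_of_monad C (tensor_monad C B))"
    if "frobenius_monoid C B" for B
    using that by (intro strong_frobenius_monad.monoid_of_monad_frobenius
        frobenius_monoid.tensor_monad_frobenius)
  have hom: "monoid_hom C B (monoid_of_monad C (tensor_monad C B)) (inv_arr C (LUnitor C (MObj B)))"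
    if "frobenius_monoid C B" for B
  proof -
    interpret frobenius_monoid C B by fact
    show ?thesis
      using GF[OF that] that
      by (intro monoid_hom_inv_arr LUnitor_monoid_hom frobenius_monoid_is_monoid) simp_all
  qed
  have "natural_transformation ?F ?F ?I ?GF ?\<eta>"
  proof (rule natural_transformationI)
    fix f assume f: "f \<in> Arr ?F"
    then have "OnArr (tensor_functor C) f \<in> Arr (StrongFrobMonads C)"
      by (rule is_functor_Arr(1)[OF tensor_functor_is_functor])
    moreover have "und f \<in> Arr C" "Dom C (und f) = MObj (src f)" "Cod C (und f) = MObj (tgt f)"
      using f by (auto simp: monoid_hom_simps)
    ultimately show "?\<eta> (Cod ?F f) \<cdot>\<^bsub>?F\<^esub> OnArr ?I f = OnArr ?GF f \<cdot>\<^bsub>?F\<^esub> ?\<eta> (Dom ?F f)"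
      using f LUnitor_inv_nat[of "und f"]
      by (simp add: tensor_functor_def eval_unit_functor_def)
  next
    show "is_functor ?F ?F ?GF"
      by (rule comp_functor_is_functor[OF tensor_functor_is_functor eval_unit_functor_is_functor])
  qed (use GF hom in \<open>simp_all add: F.id_functor_is_functor tensor_functor_def eval_unit_functor_def
      frobenius_monoid.tensor_monad_frobenius\<close>)
  moreover have "is_iso ?F (?\<eta> B)" if B: "B \<in> Obj ?F" for B
  proof -
    interpret frobenius_monoid C B using B by simp
    have "inverse_arrows C (inv_arr C (LUnitor C (MObj B))) (LUnitor C (MObj B))"
      by (simp add: inverse_arrows_def Hom_iff)
    then show ?thesis
      using B by (intro FrobMonoids_is_iso) (simp_all add: GF hom is_isoI)
  qed
  ultimately show ?thesis
    by (simp add: natural_isomorphism_def)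
qed

text \<open>Each component is a morphism of strong monads with invertible comparisons, the strength
  being unitary; naturality in T is \<open>strong_monad_hom_comparison\<close>.\<close>

lemma equivalence_counit:
  "natural_isomorphism (StrongFrobMonads C) (StrongFrobMonads C)
     (comp_functor (StrongFrobMonads C) (tensor_functor C) (eval_unit_functor C))
     (id_functor (StrongFrobMonads C))
     (\<lambda>T \<in> Obj (StrongFrobMonads C).
        StrArr (tensor_monad C (monoid_of_monad C T)) T (\<lambda>A \<in> Obj C. tensor_comparison C T A))"
  (is "natural_isomorphism ?S ?S ?FG ?I ?\<epsilon>")
proof -
  interpret S: category ?S by (rule StrongFrobMonads_category)
  have FG: "strong_frobenius_monad C (tensor_monad C (monoid_of_monad C T))"
    if "strong_frobenius_monad C T" for T
    using that by (intro strong_frobenius_monad.monoid_of_monad_frobenius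
        frobenius_monoid.tensor_monad_frobenius)
  have "natural_transformation ?S ?S ?FG ?I ?\<epsilon>"
  proof (rule natural_transformationI)
    fix \<beta> assume \<beta>: "\<beta> \<in> Arr ?S"
    then have "OnArr (eval_unit_functor C) \<beta> \<in> Arr (FrobMonoids C)"
      by (rule is_functor_Arr(1)[OF eval_unit_functor_is_functor])
    then show "?\<epsilon> (Cod ?S \<beta>) \<cdot>\<^bsub>?S\<^esub> OnArr ?FG \<beta> = OnArr ?I \<beta> \<cdot>\<^bsub>?S\<^esub> ?\<epsilon> (Dom ?S \<beta>)"
      using \<beta> strong_monad_hom_comparison[of C "src \<beta>" "tgt \<beta>" "und \<beta>"]
      by (simp add: tensor_functor_def eval_unit_functor_def strong_frobenius_monad_is_strong
          cong: restrict_cong)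
  next
    show "is_functor ?S ?S ?FG"
      by (rule comp_functor_is_functor[OF eval_unit_functor_is_functor tensor_functor_is_functor])
  qed (use FG in \<open>simp_all add: S.id_functor_is_functor tensor_functor_def eval_unit_functor_def
      strong_frobenius_monad.monoid_of_monad_frobenius strong_frobenius_monad_is_strong
      comparison_strong_monad_hom\<close>)
  moreover have "is_iso ?S (?\<epsilon> T)" if "T \<in> Obj ?S" for T
    using that by (intro StrongFrobMonads_is_iso)
      (simp_all add: FG comparison_strong_monad_hom strong_frobenius_monad_is_strong
        strong_frobenius_monad.comparison_iso)
  ultimately show ?thesis
    by (simp add: natural_isomorphism_def)
qed

end

theorem theorem4p9:
  fixes C :: "('o, 'm) dag_mon_cat"
  assumes "monoidal_dagger_category C"
  shows "equivalence_of_categories (FrobMonoids C) (StrongFrobMonads C)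
           (tensor_functor C) (eval_unit_functor C)"
proof -
  interpret monoidal_dagger_category C by (rule assms)
  show ?thesis
    unfolding equivalence_of_categories_def
    using tensor_functor_is_functor eval_unit_functor_is_functor equivalence_unit equivalence_counit
    by blast
qed

end
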